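(* Let $0<p<1$ and $k,r,m\in\mathbb{N}$. There is a constant $C$, independent of $f$ and $\delta$, such that for every function $f$ on $\mathbb{T}$ with $f^{(r-1)}\in AC(\mathbb{T})$ and every $\delta>0$, $$\omega_{r+k}(f,\delta)_p\le C\delta^r\omega_k(f^{(r)},\delta)_p+C\delta^{r+\frac1p-1}\left(\int_0^\delta\frac{\omega_m(f^{(r)},t)_p^p}{t^{2-p}}\,dt\right)^{\frac1p}.$$
   Context: $\mathbb{T}\cong[0,2\pi)$ is the unit circle, and functions on $\mathbb{T}$ are identified with $2\pi$-periodic functions; $\|f\|_p=\left(\int_{\mathbb{T}}|f(x)|^p\,dx\right)^{1/p}$. $AC(\mathbb{T})$ is the set of absolutely continuous ($2\pi$-periodic) functions; when $f^{(r-1)}\in AC(\mathbb{T})$, $f^{(r)}$ denotes the (a.e. defined, integrable) derivative of $f^{(r-1)}$. For $s\in\mathbb{N}$ the modulus of smoothness of order $s$ is $\omega_s(f,\delta)_p=\sup_{0<h\le\delta}\|\Delta_h^sf\|_p$, where $\Delta_h^sf(x)=\sum_{\nu=0}^s\binom{s}{\nu}(-1)^\nu f(x+\nu h)$. The right-hand side is allowed to be $+\infty$, in which case the inequality is trivial. *)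

theory Defs
  imports "HOL-Analysis.Analysis"
begin

text \<open>Functions on the circle are \<open>2\<pi>\<close>-periodic functions on the reals; their values are
  complex, which includes the real-valued case.\<close>

definition periodic_2pi :: "(real \<Rightarrow> 'a) \<Rightarrow> bool" where
  "periodic_2pi f \<longleftrightarrow> (\<forall>x. f (x + 2 * pi) = f x)"

text \<open>Degenerate intervals (\<open>a i = b i\<close>) are allowed; they contribute nothing to either sum.\<close>

definition abs_continuous_on_Icc ::
    "real \<Rightarrow> real \<Rightarrow> (real \<Rightarrow> 'a::real_normed_vector) \<Rightarrow> bool" where
  "abs_continuous_on_Icc l u g \<longleftrightarrow>
     (\<forall>\<epsilon>>0. \<exists>\<eta>>0. \<forall>(n::nat) (a::nat \<Rightarrow> real) (b::nat \<Rightarrow> real).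
        (\<forall>i<n. l \<le> a i \<and> a i \<le> b i \<and> b i \<le> u) \<longrightarrow>
        disjoint_family_on (\<lambda>i. {a i<..<b i}) {..<n} \<longrightarrow>
        (\<Sum>i<n. b i - a i) < \<eta> \<longrightarrow>
        (\<Sum>i<n. norm (g (b i) - g (a i))) < \<epsilon>)"

definition AC_circle :: "(real \<Rightarrow> complex) set" where
  "AC_circle = {g. periodic_2pi g \<and> abs_continuous_on_Icc 0 (2 * pi) g}"

text \<open>At a point where the derivative in question does not exist, the value below is unspecified
  (it is the same for all such points); this is harmless when the derivative exists almost
  everywhere.\<close>

definition nth_derivative :: "nat \<Rightarrow> (real \<Rightarrow> complex) \<Rightarrow> real \<Rightarrow> complex" where
  "nth_derivative n f = ((\<lambda>g x. vector_derivative g (at x)) ^^ n) f"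

text \<open>\<open>f\<close> is a function on the circle with \<open>f\<^sup>(\<^sup>r\<^sup>-\<^sup>1\<^sup>)\<close> in \<open>AC_circle\<close> (for \<open>r \<ge> 1\<close>): the derivatives
  up to order \<open>r - 1\<close> exist at every point.\<close>

definition deriv_in_AC_circle :: "nat \<Rightarrow> (real \<Rightarrow> complex) \<Rightarrow> bool" where
  "deriv_in_AC_circle r f \<longleftrightarrow>
     periodic_2pi f \<and>
     (\<forall>j<r - 1. \<forall>x. nth_derivative j f differentiable (at x)) \<and>
     nth_derivative (r - 1) f \<in> AC_circle"

text \<open>Powers with a positive exponent, extended by \<open>\<infinity>\<^sup>a = \<infinity>\<close>.\<close>

definition ennreal_powr :: "ennreal \<Rightarrow> real \<Rightarrow> ennreal" where
  "ennreal_powr x a = (if x = \<infinity> then \<infinity> else ennreal (enn2real x powr a))"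

definition Lp_norm_circle :: "real \<Rightarrow> (real \<Rightarrow> complex) \<Rightarrow> ennreal" where
  "Lp_norm_circle p f =
     ennreal_powr (\<integral>\<^sup>+x\<in>{0..<2 * pi}. ennreal (norm (f x) powr p) \<partial>lborel) (1 / p)"

definition finite_diff :: "nat \<Rightarrow> real \<Rightarrow> (real \<Rightarrow> complex) \<Rightarrow> real \<Rightarrow> complex" where
  "finite_diff s h f x = (\<Sum>\<nu>=0..s. of_nat (s choose \<nu>) * (-1) ^ \<nu> * f (x + real \<nu> * h))"

definition modulus_smoothness ::
    "nat \<Rightarrow> (real \<Rightarrow> complex) \<Rightarrow> real \<Rightarrow> real \<Rightarrow> ennreal" where
  "modulus_smoothness s f \<delta> p = (SUP h\<in>{0<..\<delta>}. Lp_norm_circle p (finite_diff s h f))"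

end

theory Submission
  imports Defs
begin

text \<open>Let \<open>g = f\<^sup>(\<^sup>r\<^sup>)\<close> and \<open>G = \<Delta>\<^sub>h\<^sup>k g\<close>, where \<open>0 < h \<le> \<delta>\<close>. Integrating \<open>r\<close> times bounds
  \<open>\<Delta>\<^sub>h\<^sup>r\<^sup>+\<^sup>k f (x)\<close> by \<open>h\<^sup>r\<^sup>-\<^sup>1\<close> times the \<open>L\<^sup>1\<close> norm of \<open>G\<close> on \<open>(x, x + r h]\<close>. For \<open>p < 1\<close> such an \<open>L\<^sup>1\<close> norm
  is not controlled by \<open>L\<^sup>p\<close> norms of \<open>G\<close> alone; the integral in the second term of the theorem is what
  makes up for this. It is the \<open>p\<close>-th power of a seminorm of the Besov space of smoothness \<open>1/p - 1\<close>
  with both exponents \<open>p\<close>, and this is exactly the smoothness that embeds into \<open>L\<^sup>1\<close>.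

  The embedding is usually obtained from piecewise polynomial approximation. Here it follows from a
  direct argument (\<open>norm_le_local_energy\<close>). Let \<open>N\<close> be the \<open>L\<^sup>1\<close> norm of \<open>G\<close> on an interval of length
  \<open>2 h\<close>. Let \<open>\<tau>\<close> be a large multiple of \<open>N / |G y|\<close>. If the translates \<open>y + \<nu> t\<close> with \<open>0 < t < \<tau>\<close> stay
  in the interval, then \<open>|G (y + \<nu> t)|\<close> is on average over these \<open>t\<close> at most \<open>N / \<tau>\<close>, hence small against
  \<open>|G y|\<close>, and \<open>\<Delta>\<^sub>t\<^sup>m G (y)\<close> is on average comparable to \<open>G y\<close>. Integration against \<open>t\<^sup>p\<^sup>-\<^sup>2\<close> gives
  \<open>|G y| \<le> C N\<^sup>1\<^sup>-\<^sup>p \<integral> t\<^sup>p\<^sup>-\<^sup>2 |\<Delta>\<^sub>t\<^sup>m G (y)|\<^sup>p dt\<close>, because \<open>\<tau>\<^sup>p\<^sup>-\<^sup>1 |G y|\<^sup>p\<close> is of the order of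
  \<open>N\<^sup>p\<^sup>-\<^sup>1 |G y|\<close>. Otherwise \<open>|G y|\<close> is at most a multiple of \<open>N / h\<close>, and the term \<open>h\<^sup>p\<^sup>-\<^sup>1 |G y|\<^sup>p\<close> does the same
  service. Integration in \<open>y\<close> bounds \<open>N\<close> on an interval by \<open>N\<^sup>1\<^sup>-\<^sup>p\<close> on a larger one times quantities
  linear in \<open>p\<close>-th powers; after integration over the circle the larger interval is absorbed
  (\<open>local_L1_Lp_le\<close>). The absorption uses that \<open>G\<close> is integrable, so that \<open>N\<close> is finite.

  The remaining ingredient is Lebesgue's fundamental theorem of calculus (\<open>AC_circle_derivative\<close>): an
  absolutely continuous function is differentiable almost everywhere and is the integral of its
  derivative. The Jordan decomposition reduces the existence of an integrand to monotone functions,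
  whose Stieltjes measures have Radon-Nikodym densities, and Vitali's covering theorem shows that an
  indefinite integral has its integrand as derivative almost everywhere.\<close>

section \<open>Averages over shrinking intervals\<close>

text \<open>The germ of Lebesgue's differentiation theorem: open neighbourhoods of the zero set on which the
  integral of \<open>\<psi>\<close> is tiny leave, by Vitali's covering theorem, no room for a non-null set of points at
  which the averages stay large.\<close>

lemma AE_small_averages_on_zero_set:
  fixes \<psi> :: "real \<Rightarrow> real"
  assumes int: "integrable lborel \<psi>" and nn: "\<And>x. 0 \<le> \<psi> x"
  shows "AE x in lborel. \<psi> x = 0 \<longrightarrow>
    (\<forall>e>0. \<exists>d>0. \<forall>a b. a \<le> x \<longrightarrow> x \<le> b \<longrightarrow> a < b \<longrightarrow> b - a < d \<longrightarrow>
       (\<integral>t\<in>{a..b}. \<psi> t \<partial>lborel) \<le> e * (b - a))"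
proof -
  define M where "M = density lborel (\<lambda>x. ennreal (\<psi> x))"
  have meas[measurable]: "\<psi> \<in> borel_measurable borel" using int by auto
  have M_eq: "emeasure M A = ennreal (\<integral>t\<in>A. \<psi> t \<partial>lborel)" if "A \<in> sets borel" for A
  proof -
    have "set_integrable lborel A \<psi>"
      unfolding set_integrable_def using that by (intro integrable_mult_indicator int) auto
    hence "(\<integral>\<^sup>+x. ennreal (indicator A x * \<psi> x) \<partial>lborel) = ennreal (\<integral>t\<in>A. \<psi> t \<partial>lborel)"
      unfolding set_lebesgue_integral_def set_integrable_def
      by (subst nn_integral_eq_integral) (auto simp: nn)
    moreover have "emeasure M A = (\<integral>\<^sup>+x. ennreal (\<psi> x) * indicator A x \<partial>lborel)"
      unfolding M_def using that by (intro emeasure_density) auto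
    ultimately show ?thesis
      by (simp add: ennreal_mult'' nn mult.commute ennreal_indicator)
  qed
  have fin: "emeasure M (space M) \<noteq> \<infinity>"
    using M_eq[of UNIV] by (simp add: M_def)
  have setsM: "sets M = sets borel" by (simp add: M_def)
  define bad where "bad = (\<lambda>e::real. {x. \<psi> x = 0 \<and> (\<forall>d>0. \<exists>a b. a \<le> x \<and> x \<le> b \<and> a < b \<and> b - a < d \<and>
       e * (b - a) < (\<integral>t\<in>{a..b}. \<psi> t \<partial>lborel))})"
  have neg: "negligible (bad e)" if e: "e > 0" for e
  proof -
    have "\<exists>T. bad e \<subseteq> T \<and> T \<in> lmeasurable \<and> measure lebesgue T \<le> \<epsilon>" if \<epsilon>: "\<epsilon> > 0" for \<epsilon> :: real
    proof -
      let ?Z = "{x. \<psi> x = 0}"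
      have Zm: "?Z \<in> sets borel" by measurable
      \<comment> \<open>The measure with density \<open>\<psi>\<close> gives no mass to the zero set, hence little mass to a suitable open
        neighbourhood \<open>U\<close> of it.\<close>
      have "emeasure M ?Z = 0"
        unfolding M_def using Zm
        by (subst emeasure_density) (auto simp: nn_integral_0_iff_AE indicator_def)
      moreover have "emeasure M ?Z = (INF U\<in>{U. ?Z \<subseteq> U \<and> open U}. emeasure M U)"
        by (rule outer_regular[OF setsM fin Zm])
      ultimately have "(INF U\<in>{U. ?Z \<subseteq> U \<and> open U}. emeasure M U) < ennreal (e * \<epsilon>)"
        using e \<epsilon> by simp
      then obtain U where U: "?Z \<subseteq> U" "open U" "emeasure M U < ennreal (e * \<epsilon>)"
        by (auto simp: INF_less_iff)
      \<comment> \<open>Closed intervals in \<open>U\<close> with a large average; they cover the bad points finely, and disjoint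
        ones have total length at most \<open>\<epsilon>\<close>.\<close>
      define K where "K = {(c, r). 0 < r \<and> cball c r \<subseteq> U \<and> e * (2 * r) < (\<integral>t\<in>cball c r. \<psi> t \<partial>lborel)}"
      have cov: "\<exists>i. i \<in> K \<and> x \<in> cball (fst i) (snd i) \<and> snd i < d" if x: "x \<in> bad e" and d: "d > 0" for x d
      proof -
        have "x \<in> U" using x U unfolding bad_def by auto
        then obtain \<rho> where \<rho>: "\<rho> > 0" "cball x \<rho> \<subseteq> U" using U(2) open_contains_cball by blast
        obtain a b where ab: "a \<le> x" "x \<le> b" "a < b" "b - a < min d \<rho>"
          "e * (b - a) < (\<integral>t\<in>{a..b}. \<psi> t \<partial>lborel)"
          using x d \<rho>(1) unfolding bad_def by (smt (verit) mem_Collect_eq min_less_iff_conj)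
        have cb: "cball ((a+b)/2) ((b-a)/2) = {a..b}"
          by (simp add: cball_eq_atLeastAtMost field_simps)
        have "{a..b} \<subseteq> cball x \<rho>" using ab by (auto simp: dist_real_def)
        hence "((a+b)/2, (b-a)/2) \<in> K" unfolding K_def using cb ab \<rho> by (auto simp: field_simps)
        thus ?thesis using ab cb by (intro exI[of _ "((a+b)/2, (b-a)/2)"]) auto
      qed
      obtain C where C: "countable C" "C \<subseteq> K"
         "pairwise (\<lambda>i j. disjnt (cball (fst i) (snd i)) (cball (fst j) (snd j))) C"
         "negligible (bad e - (\<Union>i\<in>C. cball (fst i) (snd i)))"
        using Vitali_covering_theorem_cballs[of K snd "bad e" fst] cov
        by (smt (verit, best) K_def case_prod_unfold mem_Collect_eq)
      define W where "W = (\<Union>i\<in>C. cball (fst i) (snd i))"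
      have Wm: "W \<in> sets borel" unfolding W_def using C(1) by (intro sets.countable_UN'') auto
      have disj: "disjoint_family_on (\<lambda>i. cball (fst i) (snd i)) C"
        using C(3) by (auto simp: disjoint_family_on_def pairwise_def disjnt_def)
      have "ennreal e * emeasure lborel W = ennreal e * (\<integral>\<^sup>+i. emeasure lborel (cball (fst i) (snd i)) \<partial>count_space C)"
        unfolding W_def using C(1) disj by (subst emeasure_UN_countable) auto
      also have "\<dots> = (\<integral>\<^sup>+i. ennreal e * emeasure lborel (cball (fst i) (snd i)) \<partial>count_space C)"
        by (rule nn_integral_cmult[symmetric]) auto
      also have "\<dots> \<le> (\<integral>\<^sup>+i. emeasure M (cball (fst i) (snd i)) \<partial>count_space C)"
      proof (rule nn_integral_mono)
        fix i assume "i \<in> space (count_space C)"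
        hence "i \<in> K" using C by auto
        thus "ennreal e * emeasure lborel (cball (fst i) (snd i)) \<le> emeasure M (cball (fst i) (snd i))"
          using e by (auto simp: K_def M_eq cball_eq_atLeastAtMost ennreal_mult[symmetric] intro!: ennreal_leI)
      qed
      also have "\<dots> = emeasure M W"
        unfolding W_def using C(1) disj by (subst emeasure_UN_countable) (auto simp: setsM)
      also have "\<dots> \<le> emeasure M U"
        using U(2) C(2) by (intro emeasure_mono) (fastforce simp: W_def K_def setsM)+
      also have "\<dots> < ennreal (e * \<epsilon>)" by fact
      finally have *: "ennreal e * emeasure lborel W < ennreal e * ennreal \<epsilon>"
        using e \<epsilon> by (simp add: ennreal_mult)
      have We: "emeasure lborel W < ennreal \<epsilon>"
        using * e by (metis ennreal_mult_le_mult_iff ennreal_neq_top not_le ennreal_eq_0_iff)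
      have Wl: "W \<in> lmeasurable" 
        using Wm We by (intro fmeasurableI) (auto intro: less_trans)
      have Wme: "measure lebesgue W \<le> \<epsilon>"
        using We Wm \<epsilon> by (simp add: measure_def) (metis enn2real_leI order_less_imp_le)
      define N where "N = bad e - W"
      have "negligible N" using C(4) by (simp add: N_def W_def)
      hence "N \<in> lmeasurable" "measure lebesgue N = 0"
        by (simp_all add: negligible_imp_measurable negligible_imp_measure0)
      moreover have "bad e \<subseteq> W \<union> N" by (auto simp: N_def)
      ultimately show ?thesis
        using Wl Wme measure_Un_le[of W lebesgue N]
        by (intro exI[of _ "W \<union> N"]) (auto simp: fmeasurableD fmeasurable.Un)
    qed
    thus ?thesis by (subst negligible_outer_le) auto
  qed
  have "AE x in lborel. \<forall>n. x \<notin> bad (inverse (real (Suc n)))"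
  proof (subst AE_all_countable, intro allI)
    fix n
    have "bad (inverse (real (Suc n))) \<in> null_sets lebesgue"
      using neg[of "inverse (real (Suc n))"] by (simp add: negligible_iff_null_sets)
    thus "AE x in lborel. x \<notin> bad (inverse (real (Suc n)))"
      using AE_not_in AE_completion_iff by blast
  qed
  thus ?thesis
  proof (eventually_elim, intro impI allI)
    fix x e :: real assume A: "\<forall>n. x \<notin> bad (inverse (real (Suc n)))" and z: "\<psi> x = 0" and "0 < e"
    then obtain n where n: "inverse (real (Suc n)) < e" using reals_Archimedean by blast
    obtain d where d: "d > 0" "\<And>a b. a \<le> x \<Longrightarrow> x \<le> b \<Longrightarrow> a < b \<Longrightarrow> b - a < d \<Longrightarrow>
        (\<integral>t\<in>{a..b}. \<psi> t \<partial>lborel) \<le> inverse (real (Suc n)) * (b - a)"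
      using spec[OF A, of n] z unfolding bad_def by (auto simp: not_less simp del: of_nat_Suc) (metis linorder_not_le)
    show "\<exists>d>0. \<forall>a b. a \<le> x \<longrightarrow> x \<le> b \<longrightarrow> a < b \<longrightarrow> b - a < d \<longrightarrow>
        (\<integral>t\<in>{a..b}. \<psi> t \<partial>lborel) \<le> e * (b - a)"
    proof (intro exI conjI allI impI)
      fix a b assume "a \<le> x" "x \<le> b" "a < b" "b - a < d"
      hence "(\<integral>t\<in>{a..b}. \<psi> t \<partial>lborel) \<le> inverse (real (Suc n)) * (b - a)" by (rule d)
      also have "\<dots> \<le> e * (b - a)" using n \<open>a < b\<close> by (intro mult_right_mono) auto
      finally show "(\<integral>t\<in>{a..b}. \<psi> t \<partial>lborel) \<le> e * (b - a)" .
    qed (rule d)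
  qed
qed

text \<open>Lebesgue's differentiation theorem. For \<open>q\<close> in a countable dense set the truncation
  \<open>max 0 (|\<phi> - q| - 1/(n+1))\<close> vanishes where \<open>\<phi>\<close> is close to \<open>q\<close>, so its averages tend to zero at
  almost all such points; hence the averages of \<open>\<phi>\<close> itself are eventually within \<open>O(1/n)\<close> of \<open>q\<close>,
  and of \<open>\<phi> x\<close>.\<close>

theorem AE_has_vector_derivative_indefinite_integral:
  fixes w \<phi> :: "real \<Rightarrow> complex"
  assumes int: "integrable lborel \<phi>"
    and w: "\<And>a b. l \<le> a \<Longrightarrow> a \<le> b \<Longrightarrow> b \<le> u \<Longrightarrow> w b - w a = (\<integral>t\<in>{a..b}. \<phi> t \<partial>lborel)"
  shows "AE x in lborel. l < x \<longrightarrow> x < u \<longrightarrow> (w has_vector_derivative \<phi> x) (at x)"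
proof -
  obtain D :: "complex set" where D: "countable D" "\<And>X. open X \<Longrightarrow> X \<noteq> {} \<Longrightarrow> \<exists>d\<in>D. d \<in> X"
    using countable_dense_exists by metis
  \<comment> \<open>Zero exactly where \<open>\<phi>\<close> is within \<open>1/(n+1)\<close> of \<open>q\<close> (or outside \<open>[l, u]\<close>); cut off at \<open>[l, u]\<close>
    to be integrable.\<close>
  define \<psi> where "\<psi> = (\<lambda>q n x. indicator {l..u} x * max 0 (norm (\<phi> x - q) - inverse (real (Suc n))))"
  have [measurable]: "\<phi> \<in> borel_measurable borel" using int by auto
  have \<psi>_int: "integrable lborel (\<psi> q n)" for q n
  proof (rule Bochner_Integration.integrable_bound)
    show "integrable lborel (\<lambda>x. indicator {l..u} x * norm q + norm (\<phi> x))"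
      using int by (intro Bochner_Integration.integrable_add integrable_norm integrable_mult_left integrable_real_indicator)
        (auto simp: emeasure_lborel_Icc_eq)
    show "\<psi> q n \<in> borel_measurable lborel" unfolding \<psi>_def by measurable
    show "AE x in lborel. norm (\<psi> q n x) \<le> norm (indicator {l..u} x * norm q + norm (\<phi> x))"
    proof (rule AE_I2)
      fix x
      have "norm (\<phi> x - q) \<le> norm (\<phi> x) + norm q" by (rule norm_triangle_ineq4)
      moreover obtain c where c: "inverse (real (Suc n)) = c" "0 < c" by auto
      ultimately show "norm (\<psi> q n x) \<le> norm (indicator {l..u} x * norm q + norm (\<phi> x))"
        using c(2) unfolding \<psi>_def c(1) by (cases "x \<in> {l..u}") simp_all
    qed
  qed
  have \<psi>_nn: "0 \<le> \<psi> q n x" for q n x by (auto simp: \<psi>_def)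
  have "AE x in lborel. \<forall>q\<in>D. \<forall>n. \<psi> q n x = 0 \<longrightarrow> (\<forall>e>0. \<exists>d>0. \<forall>a b. a \<le> x \<longrightarrow> x \<le> b \<longrightarrow> a < b \<longrightarrow> b - a < d \<longrightarrow>
       (\<integral>t\<in>{a..b}. \<psi> q n t \<partial>lborel) \<le> e * (b - a))"
    unfolding AE_ball_countable[OF D(1)] AE_all_countable
    using AE_small_averages_on_zero_set[OF \<psi>_int \<psi>_nn] by blast
  thus ?thesis
  proof (eventually_elim, intro impI)
    fix x assume A: "\<forall>q\<in>D. \<forall>n. \<psi> q n x = 0 \<longrightarrow> (\<forall>e>0. \<exists>d>0. \<forall>a b. a \<le> x \<longrightarrow> x \<le> b \<longrightarrow> a < b \<longrightarrow> b - a < d \<longrightarrow>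
       (\<integral>t\<in>{a..b}. \<psi> q n t \<partial>lborel) \<le> e * (b - a))" and lx: "l < x" and xu: "x < u"
    have key: "\<exists>d>0. \<forall>a b. a \<le> x \<longrightarrow> x \<le> b \<longrightarrow> b - a < d \<longrightarrow> norm (w b - w a - (b - a) *\<^sub>R \<phi> x) \<le> e * (b - a)"
      if e: "e > 0" for e
    proof -
      obtain n where n: "inverse (real (Suc n)) < e / 3" using reals_Archimedean[of "e/3"] e by auto
      define \<eta> where "\<eta> = inverse (real (Suc n))"
      have \<eta>: "\<eta> > 0" "\<eta> < e / 3" using n by (auto simp: \<eta>_def)
      obtain q where q: "q \<in> D" "q \<in> ball (\<phi> x) \<eta>"
        using D(2)[of "ball (\<phi> x) \<eta>"] \<eta> by force
      have "\<psi> q n x = 0" using q by (auto simp: \<psi>_def \<eta>_def dist_norm)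
      then obtain d where d: "d > 0" "\<And>a b. a \<le> x \<Longrightarrow> x \<le> b \<Longrightarrow> a < b \<Longrightarrow> b - a < d \<Longrightarrow>
         (\<integral>t\<in>{a..b}. \<psi> q n t \<partial>lborel) \<le> \<eta> * (b - a)"
        using A q \<eta> by metis
      define d' where "d' = min d (min (x - l) (u - x))"
      have "d' > 0" using d lx xu by (auto simp: d'_def)
      moreover have "norm (w b - w a - (b - a) *\<^sub>R \<phi> x) \<le> e * (b - a)"
        if ab: "a \<le> x" "x \<le> b" "b - a < d'" for a b
      proof (cases "a = b")
        case False
        hence lt: "a < b" using ab by auto
        have sub: "l \<le> a" "b \<le> u" using ab by (auto simp: d'_def)
        have i\<phi>: "set_integrable lborel {a..b} \<phi>"
          unfolding set_integrable_def by (intro integrable_mult_indicator int) auto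
        have iq: "set_integrable lborel {a..b} (\<lambda>_. q)"
          unfolding set_integrable_def
          by (intro integrable_scaleR_left integrable_real_indicator) (auto simp: emeasure_lborel_Icc_eq)
        have ic: "set_integrable lborel {a..b} (\<lambda>_. \<eta>)"
          unfolding set_integrable_def
          by (intro integrable_scaleR_left integrable_real_indicator) (auto simp: emeasure_lborel_Icc_eq)
        have i\<psi>: "set_integrable lborel {a..b} (\<psi> q n)"
          unfolding set_integrable_def by (intro integrable_mult_indicator \<psi>_int) auto
        have "w b - w a - (b - a) *\<^sub>R q = (\<integral>t\<in>{a..b}. \<phi> t \<partial>lborel) - (\<integral>t\<in>{a..b}. q \<partial>lborel)"
          using w[of a b] sub lt by (simp add: set_lebesgue_integral_def)
        also have "\<dots> = (\<integral>t\<in>{a..b}. \<phi> t - q \<partial>lborel)"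
          using i\<phi> iq by (rule set_integral_diff(2)[symmetric])
        also have "norm \<dots> \<le> (\<integral>t\<in>{a..b}. norm (\<phi> t - q) \<partial>lborel)"
          using set_integral_diff(1)[OF i\<phi> iq] by (rule set_integral_norm_bound)
        also have "\<dots> \<le> (\<integral>t\<in>{a..b}. \<psi> q n t + \<eta> \<partial>lborel)"
        proof (rule set_integral_mono)
          show "set_integrable lborel {a..b} (\<lambda>t. norm (\<phi> t - q))"
            using set_integral_diff(1)[OF i\<phi> iq] by (rule set_integrable_norm)
          show "set_integrable lborel {a..b} (\<lambda>t. \<psi> q n t + \<eta>)"
            using i\<psi> ic by (rule set_integral_add(1))
          show "norm (\<phi> t - q) \<le> \<psi> q n t + \<eta>" if "t \<in> {a..b}" for t
            using that sub by (auto simp: \<psi>_def \<eta>_def)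
        qed
        also have "\<dots> = (\<integral>t\<in>{a..b}. \<psi> q n t \<partial>lborel) + (\<integral>t\<in>{a..b}. \<eta> \<partial>lborel)"
          using i\<psi> ic by (rule set_integral_add(2))
        also have "(\<integral>t\<in>{a..b}. \<eta> \<partial>lborel) = \<eta> * (b - a)"
          using lt by (simp add: set_lebesgue_integral_def)
        also have "(\<integral>t\<in>{a..b}. \<psi> q n t \<partial>lborel) \<le> \<eta> * (b - a)"
          using ab lt by (intro d(2)) (auto simp: d'_def)
        finally have 1: "norm (w b - w a - (b - a) *\<^sub>R q) \<le> 2 * \<eta> * (b - a)" by (simp add: algebra_simps)
        have 2: "norm ((b - a) *\<^sub>R q - (b - a) *\<^sub>R \<phi> x) \<le> \<eta> * (b - a)"
        proof -
          have "norm ((b - a) *\<^sub>R q - (b - a) *\<^sub>R \<phi> x) = (b - a) * norm (q - \<phi> x)"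
            using lt by (simp flip: scaleR_diff_right)
          also have "\<dots> \<le> (b - a) * \<eta>" using q lt by (intro mult_left_mono) (auto simp: dist_norm norm_minus_commute)
          finally show ?thesis by (simp add: mult.commute)
        qed
        have "norm ((w b - w a - (b - a) *\<^sub>R q) + ((b - a) *\<^sub>R q - (b - a) *\<^sub>R \<phi> x)) \<le> 2 * \<eta> * (b - a) + \<eta> * (b - a)"
          by (rule norm_triangle_le[OF add_mono[OF 1 2]])
        hence "norm (w b - w a - (b - a) *\<^sub>R \<phi> x) \<le> 2 * \<eta> * (b - a) + \<eta> * (b - a)" by (simp only: diff_add_cancel add_diff_eq)
        also have "\<dots> = (3 * \<eta>) * (b - a)" by simp
        also have "\<dots> \<le> e * (b - a)" using \<eta> lt by (intro mult_right_mono) auto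
        finally show ?thesis .
      qed auto
      ultimately show ?thesis by blast
    qed
    show "(w has_vector_derivative \<phi> x) (at x)"
      unfolding has_vector_derivative_def has_derivative_at_alt
    proof (intro conjI allI impI)
      show "bounded_linear (\<lambda>xa. xa *\<^sub>R \<phi> x)" by (rule bounded_linear_scaleR_left)
      fix e :: real assume "e > 0"
      from key[OF this] obtain d where d: "d > 0" "\<And>a b. a \<le> x \<Longrightarrow> x \<le> b \<Longrightarrow> b - a < d \<Longrightarrow> norm (w b - w a - (b - a) *\<^sub>R \<phi> x) \<le> e * (b - a)"
        by blast
      show "\<exists>d>0. \<forall>y. norm (y - x) < d \<longrightarrow> norm (w y - w x - (y - x) *\<^sub>R \<phi> x) \<le> e * norm (y - x)"
      proof (intro exI[of _ d] conjI allI impI)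
        fix y assume y: "norm (y - x) < d"
        show "norm (w y - w x - (y - x) *\<^sub>R \<phi> x) \<le> e * norm (y - x)"
        proof (cases "x \<le> y")
          case True
          thus ?thesis using d(2)[of x y] y by auto
        next
          case False
          have "norm (w y - w x - (y - x) *\<^sub>R \<phi> x) = norm (w x - w y - (x - y) *\<^sub>R \<phi> x)"
            by (subst norm_minus_cancel[symmetric]) (simp add: algebra_simps)
          thus ?thesis using d(2)[of y x] y False by auto
        qed
      qed (rule d)
    qed
  qed
qed

section \<open>Positive variation of an absolutely continuous function\<close>

text \<open>A finite family of non-overlapping intervals, indexed by an arbitrary finite set rather than by
  an initial segment: families can then be merged and split without renumbering.\<close>

definition interval_family :: "nat set \<Rightarrow> (nat \<Rightarrow> real) \<Rightarrow> (nat \<Rightarrow> real) \<Rightarrow> real \<Rightarrow> real \<Rightarrow> bool" where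
  "interval_family I a b l u \<longleftrightarrow> finite I \<and> (\<forall>i\<in>I. l \<le> a i \<and> a i \<le> b i \<and> b i \<le> u) \<and>
     disjoint_family_on (\<lambda>i. {a i<..<b i}) I"

lemma interval_family_length_le:
  assumes "interval_family I a b l u" "l \<le> u"
  shows "(\<Sum>i\<in>I. b i - a i) \<le> u - l"
proof -
  have fin: "finite I" and sub: "\<And>i. i \<in> I \<Longrightarrow> l \<le> a i \<and> a i \<le> b i \<and> b i \<le> u"
    and dis: "disjoint_family_on (\<lambda>i. {a i<..<b i}) I"
    using assms by (auto simp: interval_family_def)
  have "(\<Sum>i\<in>I. b i - a i) = (\<Sum>i\<in>I. measure lborel {a i<..<b i})"
    using sub by (intro sum.cong) auto
  also have "\<dots> = measure lborel (\<Union>i\<in>I. {a i<..<b i})"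
    using fin dis sub by (intro measure_finite_Union[symmetric]) auto
  also have "\<dots> \<le> measure lborel {l..u}"
    using sub by (intro measure_mono_fmeasurable) (force simp: fmeasurable_def emeasure_lborel_Icc_eq)+
  also have "\<dots> = u - l" using assms by simp
  finally show ?thesis .
qed

lemma abs_continuous_on_IccD:
  assumes "abs_continuous_on_Icc l u g" "\<epsilon> > 0"
  obtains \<eta> where "\<eta> > 0"
    "\<And>I a b. interval_family I a b l u \<Longrightarrow> (\<Sum>i\<in>I. b i - a i) < \<eta> \<Longrightarrow> (\<Sum>i\<in>I. norm (g (b i) - g (a i))) < \<epsilon>"
proof -
  define P where "P \<eta> \<longleftrightarrow> (\<forall>(n::nat) a b. (\<forall>i<n. l \<le> a i \<and> a i \<le> b i \<and> b i \<le> u) \<longrightarrow>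
        disjoint_family_on (\<lambda>i. {a i<..<b i}) {..<n} \<longrightarrow>
        (\<Sum>i<n. b i - a i) < \<eta> \<longrightarrow> (\<Sum>i<n. norm (g (b i) - g (a i))) < \<epsilon>)" for \<eta>
  obtain \<eta> where "\<eta> > 0" "P \<eta>"
    using spec[OF assms(1)[unfolded abs_continuous_on_Icc_def], of \<epsilon>] assms(2)
    unfolding P_def[symmetric] by blast
  note \<eta> = this[unfolded P_def]
  show ?thesis
  proof (rule that[OF \<eta>(1)])
    fix I a b assume F: "interval_family I a b l u" and s: "(\<Sum>i\<in>I. b i - a i) < \<eta>"
    then obtain h where h: "bij_betw h {..<card I} I"
      using ex_bij_betw_nat_finite[of I] by (auto simp: interval_family_def atLeast0LessThan)
    have "(\<Sum>i<card I. b (h i) - a (h i)) < \<eta>"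
      using s sum.reindex_bij_betw[OF h, of "\<lambda>i. b i - a i"] by simp
    moreover have "\<forall>i<card I. l \<le> a (h i) \<and> a (h i) \<le> b (h i) \<and> b (h i) \<le> u"
      using F bij_betwE[OF h] by (auto simp: interval_family_def)
    moreover have "disjoint_family_on (\<lambda>i. {a (h i)<..<b (h i)}) {..<card I}"
      unfolding disjoint_family_on_def
    proof (intro ballI impI)
      fix i j assume ij: "i \<in> {..<card I}" "j \<in> {..<card I}" "i \<noteq> j"
      hence "h i \<in> I" "h j \<in> I" "h i \<noteq> h j"
        using bij_betwE[OF h] bij_betw_imp_inj_on[OF h] by (auto dest: inj_onD)
      thus "{a (h i)<..<b (h i)} \<inter> {a (h j)<..<b (h j)} = {}"
        using F unfolding interval_family_def disjoint_family_on_def by blast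
    qed
    ultimately have "(\<Sum>i<card I. norm (g (b (h i)) - g (a (h i)))) < \<epsilon>"
      using \<eta>(2)[rule_format, of "card I" "a \<circ> h" "b \<circ> h"] by simp
    thus "(\<Sum>i\<in>I. norm (g (b i) - g (a i))) < \<epsilon>"
      using sum.reindex_bij_betw[OF h, of "\<lambda>i. norm (g (b i) - g (a i))"] by simp
  qed
qed

definition increments :: "(real \<Rightarrow> real) \<Rightarrow> real \<Rightarrow> real \<Rightarrow> real set" where
  "increments w x y = {\<Sum>i\<in>I. w (b i) - w (a i) |I a b. interval_family I a b x y}"

text \<open>For a function that is not absolutely continuous the supremum may be over an unbounded set, and
  the value is then unspecified.\<close>

definition pos_variation :: "(real \<Rightarrow> real) \<Rightarrow> real \<Rightarrow> real \<Rightarrow> real" where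
  "pos_variation w x y = Sup (increments w x y)"

lemma increment_mem_increments: "x \<le> y \<Longrightarrow> w y - w x \<in> increments w x y"
  unfolding increments_def interval_family_def
  by (intro CollectI exI[of _ "{0}"] exI[of _ "\<lambda>_. x"] exI[of _ "\<lambda>_. y"]) (auto simp: disjoint_family_on_def)

lemma zero_mem_increments: "0 \<in> increments w x y"
  unfolding increments_def interval_family_def
  by (intro CollectI exI[of _ "{}"]) (auto simp: disjoint_family_on_def)

lemma increments_join:
  assumes "s \<in> increments w x y" "t \<in> increments w y z" "x \<le> y" "y \<le> z"
  shows "s + t \<in> increments w x z"
proof -
  obtain I a b where I: "s = (\<Sum>i\<in>I. w (b i) - w (a i))" "interval_family I a b x y"
    using assms by (auto simp: increments_def)
  obtain J c d where J: "t = (\<Sum>i\<in>J. w (d i) - w (c i))" "interval_family J c d y z"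
    using assms by (auto simp: increments_def)
  \<comment> \<open>The two families are put on the even and on the odd indices.\<close>
  define K where "K = (\<lambda>i. 2 * i) ` I \<union> (\<lambda>i. 2 * i + 1) ` J"
  define e where "e = (\<lambda>i::nat. if even i then a (i div 2) else c (i div 2))"
  define f where "f = (\<lambda>i::nat. if even i then b (i div 2) else d (i div 2))"
  have fin: "finite I" "finite J" using I J by (auto simp: interval_family_def)
  have "interval_family K e f x z"
    unfolding interval_family_def
  proof (intro conjI ballI)
    show "finite K" using fin by (auto simp: K_def)
    show "x \<le> e i" "e i \<le> f i" "f i \<le> z" if "i \<in> K" for i
      using that I J assms by (auto simp: interval_family_def K_def e_def f_def intro: order_trans)
    show "disjoint_family_on (\<lambda>i. {e i<..<f i}) K"
      unfolding disjoint_family_on_def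
    proof (intro ballI impI)
      have cross: "{a i<..<b i} \<inter> {c j<..<d j} = {}" if "i \<in> I" "j \<in> J" for i j
        using that I(2) J(2) unfolding interval_family_def by force
      fix i j assume "i \<in> K" "j \<in> K" "i \<noteq> j"
      then consider i' j' where "i' \<in> I" "j' \<in> I" "i = 2 * i'" "j = 2 * j'" "i' \<noteq> j'"
        | i' j' where "i' \<in> J" "j' \<in> J" "i = 2 * i' + 1" "j = 2 * j' + 1" "i' \<noteq> j'"
        | i' j' where "i' \<in> I" "j' \<in> J" "i = 2 * i'" "j = 2 * j' + 1"
        | i' j' where "i' \<in> J" "j' \<in> I" "i = 2 * i' + 1" "j = 2 * j'"
        unfolding K_def by blast
      thus "{e i<..<f i} \<inter> {e j<..<f j} = {}"
      proof cases
        case 1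
        thus ?thesis using I(2) by (simp add: e_def f_def interval_family_def disjoint_family_on_def)
      next
        case 2
        thus ?thesis using J(2) by (simp add: e_def f_def interval_family_def disjoint_family_on_def)
      next
        case 3
        thus ?thesis using cross[of i' j'] by (simp add: e_def f_def)
      next
        case 4
        thus ?thesis using cross[of j' i'] by (simp add: e_def f_def Int_commute)
      qed
    qed
  qed
  moreover have "(\<Sum>i\<in>K. w (f i) - w (e i)) = s + t"
  proof -
    have "(\<Sum>i\<in>K. w (f i) - w (e i)) = (\<Sum>i\<in>(\<lambda>i. 2 * i) ` I. w (f i) - w (e i)) + (\<Sum>i\<in>(\<lambda>i. 2 * i + 1) ` J. w (f i) - w (e i))"
      unfolding K_def using fin by (intro sum.union_disjoint) (auto, presburger)
    also have "(\<Sum>i\<in>(\<lambda>i. 2 * i) ` I. w (f i) - w (e i)) = s"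
      unfolding I(1) by (subst sum.reindex) (auto simp: inj_on_def e_def f_def)
    also have "(\<Sum>i\<in>(\<lambda>i. 2 * i + 1) ` J. w (f i) - w (e i)) = t"
      unfolding J(1) by (subst sum.reindex) (auto simp: inj_on_def e_def f_def)
    finally show ?thesis .
  qed
  ultimately show ?thesis unfolding increments_def by (intro CollectI exI conjI) (rule sym)
qed

text \<open>Together with the previous lemma this makes the positive variation additive.\<close>

lemma increments_split:
  assumes "s \<in> increments w x z" "x \<le> y" "y \<le> z"
  obtains s1 s2 where "s1 \<in> increments w x y" "s2 \<in> increments w y z" "s = s1 + s2"
proof -
  obtain I a b where I: "s = (\<Sum>i\<in>I. w (b i) - w (a i))" "interval_family I a b x z"
    using assms by (auto simp: increments_def)
  \<comment> \<open>Clamping the end points at \<open>y\<close> cuts every interval into its parts on either side of \<open>y\<close>, one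
    of which may be degenerate.\<close>
  have 1: "interval_family I (\<lambda>i. min (a i) y) (\<lambda>i. min (b i) y) x y"
    unfolding interval_family_def
  proof (intro conjI ballI)
    have "{min (a i) y<..<min (b i) y} \<subseteq> {a i<..<b i}" for i
      by (auto simp: min_def split: if_splits)
    moreover have "disjoint_family_on (\<lambda>i. {a i<..<b i}) I" using I(2) by (simp add: interval_family_def)
    ultimately show "disjoint_family_on (\<lambda>i. {min (a i) y<..<min (b i) y}) I"
      unfolding disjoint_family_on_def by blast
  qed (use I(2) assms in \<open>auto simp: interval_family_def intro: order_trans\<close>)
  have 2: "interval_family I (\<lambda>i. max (a i) y) (\<lambda>i. max (b i) y) y z"
    unfolding interval_family_def
  proof (intro conjI ballI)
    have "{max (a i) y<..<max (b i) y} \<subseteq> {a i<..<b i}" for i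
      by (auto simp: max_def split: if_splits)
    moreover have "disjoint_family_on (\<lambda>i. {a i<..<b i}) I" using I(2) by (simp add: interval_family_def)
    ultimately show "disjoint_family_on (\<lambda>i. {max (a i) y<..<max (b i) y}) I"
      unfolding disjoint_family_on_def by blast
  qed (use I(2) assms in \<open>auto simp: interval_family_def le_max_iff_disj intro: order_trans\<close>)
  show ?thesis
  proof (rule that)
    show "(\<Sum>i\<in>I. w (min (b i) y) - w (min (a i) y)) \<in> increments w x y"
      unfolding increments_def using 1 by (intro CollectI exI conjI) (rule refl)
    show "(\<Sum>i\<in>I. w (max (b i) y) - w (max (a i) y)) \<in> increments w y z"
      unfolding increments_def using 2 by (intro CollectI exI conjI) (rule refl)
    show "s = (\<Sum>i\<in>I. w (min (b i) y) - w (min (a i) y)) + (\<Sum>i\<in>I. w (max (b i) y) - w (max (a i) y))"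
      unfolding I(1) sum.distrib[symmetric] by (intro sum.cong) (auto simp: min_def max_def)
  qed
qed

lemma increments_mono:
  assumes "l \<le> x" "y \<le> u"
  shows "increments w x y \<subseteq> increments w l u"
proof
  fix s assume "s \<in> increments w x y"
  then obtain I a b where I: "s = (\<Sum>i\<in>I. w (b i) - w (a i))" "interval_family I a b x y"
    by (auto simp: increments_def)
  have "interval_family I a b l u"
    using I(2) assms by (auto simp: interval_family_def intro: order_trans)
  thus "s \<in> increments w l u" unfolding increments_def I(1) by blast
qed

text \<open>An absolutely continuous function has bounded variation: on intervals shorter than the \<open>\<eta>\<close> that
  belongs to \<open>\<epsilon> = 1\<close> the increments are at most \<open>1\<close>, and finitely many such intervals suffice.\<close>

lemma bdd_above_increments:
  assumes ac: "abs_continuous_on_Icc l u w" and "l \<le> u"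
  shows "bdd_above (increments w l u)"
proof -
  obtain \<eta> where \<eta>: "\<eta> > 0" "\<And>I a b. interval_family I a b l u \<Longrightarrow> (\<Sum>i\<in>I. b i - a i) < \<eta> \<Longrightarrow> (\<Sum>i\<in>I. norm (w (b i) - w (a i))) < 1"
    using abs_continuous_on_IccD[OF ac, of 1] by auto
  have short: "s \<le> 1" if s: "s \<in> increments w x y" and xy: "l \<le> x" "x \<le> y" "y \<le> u" "y - x < \<eta>" for s x y
  proof -
    obtain I a b where I: "s = (\<Sum>i\<in>I. w (b i) - w (a i))" "interval_family I a b x y"
      using s by (auto simp: increments_def)
    have "interval_family I a b l u" using I(2) xy by (force simp: interval_family_def)
    moreover have "(\<Sum>i\<in>I. b i - a i) < \<eta>" using interval_family_length_le[OF I(2)] xy by simp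
    ultimately have "(\<Sum>i\<in>I. norm (w (b i) - w (a i))) < 1" by (rule \<eta>(2))
    moreover have "s \<le> (\<Sum>i\<in>I. norm (w (b i) - w (a i)))" unfolding I(1) by (intro sum_mono) auto
    ultimately show ?thesis by simp
  qed
  \<comment> \<open>Cut off pieces of length \<open>\<eta>/2\<close>, each of which contributes at most \<open>1\<close>.\<close>
  have grid: "s \<le> real n" if "s \<in> increments w x u" "l \<le> x" "x \<le> u" "u - x < real n * (\<eta> / 2)" for s x n
    using that
  proof (induction n arbitrary: s x)
    case 0
    thus ?case by simp
  next
    case (Suc n)
    show ?case
    proof (cases "u - x < \<eta>")
      case True
      thus ?thesis using short[of s x u] Suc.prems by auto
    next
      case False
      define y where "y = x + \<eta> / 2"
      have y: "x \<le> y" "y \<le> u" "l \<le> y" "y - x < \<eta>" using \<eta>(1) False Suc.prems by (auto simp: y_def)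
      obtain s1 s2 where s: "s1 \<in> increments w x y" "s2 \<in> increments w y u" "s = s1 + s2"
        using increments_split[OF Suc.prems(1) y(1,2)] .
      have "s1 \<le> 1" using short[OF s(1)] y Suc.prems by auto
      moreover have "s2 \<le> real n"
        using Suc.prems y by (intro Suc.IH[OF s(2)]) (auto simp: y_def field_simps)
      ultimately show ?thesis using s(3) by simp
    qed
  qed
  obtain n where "u - l < real n * (\<eta> / 2)" using reals_Archimedean3[of "\<eta>/2"] \<eta>(1) by (meson half_gt_zero)
  thus ?thesis using grid[of _ l n] \<open>l \<le> u\<close> by (intro bdd_aboveI[of _ "real n"]) auto
qed

lemma pos_variation_add:
  assumes ac: "abs_continuous_on_Icc l u w" and "l \<le> x" "x \<le> y" "y \<le> z" "z \<le> u"
  shows "pos_variation w x z = pos_variation w x y + pos_variation w y z"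
proof (rule antisym)
  have bdd: "bdd_above (increments w x' y')" if "l \<le> x'" "y' \<le> u" for x' y'
    using bdd_above_increments[OF ac] increments_mono[OF that, of w] assms by (meson bdd_above_mono order_trans)
  show "pos_variation w x z \<le> pos_variation w x y + pos_variation w y z"
    unfolding pos_variation_def[of w x z]
  proof (rule cSup_least)
    show "increments w x z \<noteq> {}" using zero_mem_increments by blast
    fix s assume "s \<in> increments w x z"
    then obtain s1 s2 where s: "s1 \<in> increments w x y" "s2 \<in> increments w y z" "s = s1 + s2"
      using increments_split assms by metis
    thus "s \<le> pos_variation w x y + pos_variation w y z"
      unfolding pos_variation_def s(3) using assms by (intro add_mono cSup_upper bdd) auto
  qed
  have *: "s + t \<le> pos_variation w x z" if "s \<in> increments w x y" "t \<in> increments w y z" for s t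
    unfolding pos_variation_def using increments_join[OF that] assms by (intro cSup_upper bdd) auto
  have "s \<le> pos_variation w x z - pos_variation w y z" if "s \<in> increments w x y" for s
  proof -
    have "pos_variation w y z \<le> pos_variation w x z - s"
      unfolding pos_variation_def[of w y z]
    proof (rule cSup_least)
      show "increments w y z \<noteq> {}" using zero_mem_increments by blast
      show "t \<le> pos_variation w x z - s" if "t \<in> increments w y z" for t
        using *[OF \<open>s \<in> increments w x y\<close> that] by simp
    qed
    thus ?thesis by simp
  qed
  hence "pos_variation w x y \<le> pos_variation w x z - pos_variation w y z"
    unfolding pos_variation_def[of w x y] using zero_mem_increments[of w x y] by (intro cSup_least) auto
  thus "pos_variation w x y + pos_variation w y z \<le> pos_variation w x z" by simp
qed

lemma pos_variation_ge:
  assumes ac: "abs_continuous_on_Icc l u w" and "l \<le> x" "x \<le> y" "y \<le> u"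
  shows "w y - w x \<le> pos_variation w x y" "0 \<le> pos_variation w x y"
proof -
  have bdd: "bdd_above (increments w x y)"
    using bdd_above_increments[OF ac] increments_mono[of l x y u w] assms by (meson bdd_above_mono order_trans)
  show "w y - w x \<le> pos_variation w x y" "0 \<le> pos_variation w x y"
    unfolding pos_variation_def using assms
    by (auto intro!: cSup_upper bdd increment_mem_increments zero_mem_increments)
qed

text \<open>The positive variation inherits absolute continuity: near-optimal families inside the members
  of a short family merge into a family that is no longer.\<close>

lemma pos_variation_sum_le:
  assumes ac: "abs_continuous_on_Icc l u w" and \<epsilon>: "\<epsilon> > 0"
  obtains \<eta> where "\<eta> > 0"
    "\<And>I a b. interval_family I a b l u \<Longrightarrow> (\<Sum>i\<in>I. b i - a i) < \<eta> \<Longrightarrow>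
       (\<Sum>i\<in>I. pos_variation w (a i) (b i)) \<le> \<epsilon>"
proof -
  obtain \<eta> where \<eta>: "\<eta> > 0"
    "\<And>I a b. interval_family I a b l u \<Longrightarrow> (\<Sum>i\<in>I. b i - a i) < \<eta> \<Longrightarrow> (\<Sum>i\<in>I. norm (w (b i) - w (a i))) < \<epsilon>/2"
    using abs_continuous_on_IccD[OF ac, of "\<epsilon>/2"] \<epsilon> by auto
  show ?thesis
  proof (rule that[OF \<eta>(1)])
    fix I a b assume F: "interval_family I a b l u" and len: "(\<Sum>i\<in>I. b i - a i) < \<eta>"
    have fin: "finite I" and ab: "\<And>i. i \<in> I \<Longrightarrow> l \<le> a i \<and> a i \<le> b i \<and> b i \<le> u"
      and dis: "disjoint_family_on (\<lambda>i. {a i<..<b i}) I"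
      using F by (auto simp: interval_family_def)
    \<comment> \<open>The error allowed in each of the \<open>card I\<close> suprema; the added \<open>1\<close> covers an empty \<open>I\<close>.\<close>
    define c where "c = \<epsilon> / (2 * (real (card I) + 1))"
    have c: "c > 0" "real (card I) * c \<le> \<epsilon>/2" using \<epsilon> by (auto simp: c_def field_simps)
    have "\<exists>J p q. pos_variation w (a i) (b i) - c \<le> (\<Sum>j\<in>J. w (q j) - w (p j)) \<and> interval_family J p q (a i) (b i)"
      if "i \<in> I" for i
    proof -
      have "increments w (a i) (b i) \<noteq> {}" using zero_mem_increments[of w "a i" "b i"] by blast
      moreover have "bdd_above (increments w (a i) (b i))"
        using bdd_above_increments[OF ac] increments_mono[of l "a i" "b i" u w] ab[OF that]
        by (meson bdd_above_mono order_trans)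
      moreover have "pos_variation w (a i) (b i) - c < Sup (increments w (a i) (b i))"
        using c by (simp add: pos_variation_def)
      ultimately obtain s where s: "s \<in> increments w (a i) (b i)" "pos_variation w (a i) (b i) - c < s"
        using less_cSup_iff by blast
      from s(1) obtain J p q where "s = (\<Sum>j\<in>J. w (q j) - w (p j))" "interval_family J p q (a i) (b i)"
        by (auto simp: increments_def)
      with s(2) show ?thesis by (intro exI[of _ J] exI[of _ p] exI[of _ q]) auto
    qed
    then obtain J p q where J: "\<And>i. i \<in> I \<Longrightarrow> pos_variation w (a i) (b i) - c \<le> (\<Sum>j\<in>J i. w (q i j) - w (p i j))"
      "\<And>i. i \<in> I \<Longrightarrow> interval_family (J i) (p i) (q i) (a i) (b i)"
      by metis
    \<comment> \<open>All the near-optimal families together form one family on \<open>[l, u]\<close>.\<close>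
    define K where "K = prod_encode ` (Sigma I J)"
    define p' where "p' = (\<lambda>n. case_prod p (prod_decode n))"
    define q' where "q' = (\<lambda>n. case_prod q (prod_decode n))"
    have finJ: "\<forall>i\<in>I. finite (J i)" using J(2) by (auto simp: interval_family_def)
    have sumK: "(\<Sum>n\<in>K. f (p' n) (q' n)) = (\<Sum>i\<in>I. \<Sum>j\<in>J i. f (p i j) (q i j))" for f :: "real \<Rightarrow> real \<Rightarrow> real"
    proof -
      have "(\<Sum>n\<in>K. f (p' n) (q' n)) = (\<Sum>(i,j)\<in>Sigma I J. f (p i j) (q i j))"
        unfolding K_def by (subst sum.reindex) (auto simp: p'_def q'_def intro!: sum.cong inj_prod_encode)
      also have "\<dots> = (\<Sum>i\<in>I. \<Sum>j\<in>J i. f (p i j) (q i j))"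
        using fin finJ by (intro sum.Sigma[symmetric])
      finally show ?thesis .
    qed
    have sub: "{p i j<..<q i j} \<subseteq> {a i<..<b i}" if "i \<in> I" "j \<in> J i" for i j
      using J(2)[OF that(1)] that(2) by (auto simp: interval_family_def intro: le_less_trans less_le_trans)
    have "interval_family K p' q' l u"
      unfolding interval_family_def
    proof (intro conjI ballI)
      show "finite K" using fin finJ by (auto simp: K_def)
      show "l \<le> p' n" "p' n \<le> q' n" "q' n \<le> u" if n: "n \<in> K" for n
      proof -
        obtain i j where ij: "i \<in> I" "j \<in> J i" "n = prod_encode (i, j)" using n by (auto simp: K_def)
        thus "l \<le> p' n" "p' n \<le> q' n" "q' n \<le> u"
          using J(2)[OF ij(1)] ab[OF ij(1)]
          by (auto simp: interval_family_def p'_def q'_def intro: order_trans)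
      qed
      show "disjoint_family_on (\<lambda>n. {p' n<..<q' n}) K"
        unfolding disjoint_family_on_def
      proof (intro ballI impI)
        fix n m assume "n \<in> K" "m \<in> K" and neq: "n \<noteq> m"
        then obtain i j i' j' where ij: "i \<in> I" "j \<in> J i" "n = prod_encode (i, j)"
            "i' \<in> I" "j' \<in> J i'" "m = prod_encode (i', j')" by (auto simp: K_def)
        show "{p' n<..<q' n} \<inter> {p' m<..<q' m} = {}"
        proof (cases "i = i'")
          case True
          hence "j \<noteq> j'" using neq ij by auto
          moreover have "disjoint_family_on (\<lambda>j. {p i j<..<q i j}) (J i)"
            using J(2)[OF ij(1)] by (auto simp: interval_family_def)
          ultimately have "{p i j<..<q i j} \<inter> {p i j'<..<q i j'} = {}"
            using ij True unfolding disjoint_family_on_def by blast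
          thus ?thesis using ij True by (simp add: p'_def q'_def)
        next
          case False
          hence "{a i<..<b i} \<inter> {a i'<..<b i'} = {}"
            using dis ij unfolding disjoint_family_on_def by blast
          hence "{p i j<..<q i j} \<inter> {p i' j'<..<q i' j'} = {}" using sub ij by blast
          thus ?thesis using ij by (simp add: p'_def q'_def)
        qed
      qed
    qed
    moreover have "(\<Sum>n\<in>K. q' n - p' n) < \<eta>"
    proof -
      have "(\<Sum>n\<in>K. q' n - p' n) = (\<Sum>i\<in>I. \<Sum>j\<in>J i. q i j - p i j)" by (rule sumK)
      also have "\<dots> \<le> (\<Sum>i\<in>I. b i - a i)" using J(2) ab by (intro sum_mono interval_family_length_le) auto
      finally show ?thesis using len by simp
    qed
    ultimately have "(\<Sum>n\<in>K. norm (w (q' n) - w (p' n))) < \<epsilon>/2" by (rule \<eta>(2))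
    moreover have "(\<Sum>n\<in>K. w (q' n) - w (p' n)) \<le> (\<Sum>n\<in>K. norm (w (q' n) - w (p' n)))"
      by (intro sum_mono) auto
    moreover have "(\<Sum>i\<in>I. pos_variation w (a i) (b i) - c) \<le> (\<Sum>i\<in>I. \<Sum>j\<in>J i. w (q i j) - w (p i j))"
      by (intro sum_mono J(1))
    hence "(\<Sum>i\<in>I. pos_variation w (a i) (b i) - c) \<le> (\<Sum>n\<in>K. w (q' n) - w (p' n))"
      using sumK[of "\<lambda>x y. w y - w x"] by simp
    ultimately show "(\<Sum>i\<in>I. pos_variation w (a i) (b i)) \<le> \<epsilon>"
      using c(2) by (simp add: sum_subtractf)
  qed
qed

text \<open>Jordan decomposition; \<open>F\<close> is the positive variation on \<open>[l, x]\<close>.\<close>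

lemma abs_continuous_on_Icc_decompose:
  fixes w :: "real \<Rightarrow> real"
  assumes ac: "abs_continuous_on_Icc l u w" and lu: "l \<le> u"
  obtains F G where "mono_on {l..u} F" "mono_on {l..u} G"
    "abs_continuous_on_Icc l u F" "abs_continuous_on_Icc l u G" "\<And>x. w x = F x - G x"
proof -
  define F where "F = (\<lambda>x. pos_variation w l x)"
  have F_diff: "F y - F x = pos_variation w x y" if "l \<le> x" "x \<le> y" "y \<le> u" for x y
    using pos_variation_add[OF ac, of l x y] that by (simp add: F_def)
  have acF: "abs_continuous_on_Icc l u F"
    unfolding abs_continuous_on_Icc_def
  proof (intro allI impI)
    fix \<epsilon> :: real assume "\<epsilon> > 0"
    then obtain \<eta> where \<eta>: "\<eta> > 0" "\<And>I a b. interval_family I a b l u \<Longrightarrow> (\<Sum>i\<in>I. b i - a i) < \<eta> \<Longrightarrow>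
       (\<Sum>i\<in>I. pos_variation w (a i) (b i)) \<le> \<epsilon>/2"
      using pos_variation_sum_le[OF ac, of "\<epsilon>/2"] by auto
    show "\<exists>\<eta>>0. \<forall>(n::nat) a b. (\<forall>i<n. l \<le> a i \<and> a i \<le> b i \<and> b i \<le> u) \<longrightarrow>
        disjoint_family_on (\<lambda>i. {a i<..<b i}) {..<n} \<longrightarrow>
        (\<Sum>i<n. b i - a i) < \<eta> \<longrightarrow> (\<Sum>i<n. norm (F (b i) - F (a i))) < \<epsilon>"
    proof (intro exI[of _ \<eta>] conjI allI impI \<eta>(1))
      fix n :: nat and a b :: "nat \<Rightarrow> real"
      assume ab: "\<forall>i<n. l \<le> a i \<and> a i \<le> b i \<and> b i \<le> u"
        and "disjoint_family_on (\<lambda>i. {a i<..<b i}) {..<n}" "(\<Sum>i<n. b i - a i) < \<eta>"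
      hence "(\<Sum>i<n. pos_variation w (a i) (b i)) \<le> \<epsilon>/2"
        by (intro \<eta>(2)) (auto simp: interval_family_def)
      also have "(\<Sum>i<n. pos_variation w (a i) (b i)) = (\<Sum>i<n. norm (F (b i) - F (a i)))"
        using ab pos_variation_ge(2)[OF ac] by (intro sum.cong) (auto simp: F_diff)
      finally show "(\<Sum>i<n. norm (F (b i) - F (a i))) < \<epsilon>" using \<open>\<epsilon> > 0\<close> by simp
    qed
  qed
  have acG: "abs_continuous_on_Icc l u (\<lambda>x. F x - w x)"
    unfolding abs_continuous_on_Icc_def
  proof (intro allI impI)
    fix \<epsilon> :: real assume e: "\<epsilon> > 0"
    obtain \<eta>1 where \<eta>1: "\<eta>1 > 0" "\<And>I a b. interval_family I a b l u \<Longrightarrow> (\<Sum>i\<in>I. b i - a i) < \<eta>1 \<Longrightarrow>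
       (\<Sum>i\<in>I. norm (w (b i) - w (a i))) < \<epsilon>/2"
      using abs_continuous_on_IccD[OF ac, of "\<epsilon>/2"] e by auto
    obtain \<eta>2 where \<eta>2: "\<eta>2 > 0" "\<And>I a b. interval_family I a b l u \<Longrightarrow> (\<Sum>i\<in>I. b i - a i) < \<eta>2 \<Longrightarrow>
       (\<Sum>i\<in>I. norm (F (b i) - F (a i))) < \<epsilon>/2"
      using abs_continuous_on_IccD[OF acF, of "\<epsilon>/2"] e by auto
    show "\<exists>\<eta>>0. \<forall>(n::nat) a b. (\<forall>i<n. l \<le> a i \<and> a i \<le> b i \<and> b i \<le> u) \<longrightarrow>
        disjoint_family_on (\<lambda>i. {a i<..<b i}) {..<n} \<longrightarrow>
        (\<Sum>i<n. b i - a i) < \<eta> \<longrightarrow> (\<Sum>i<n. norm ((F (b i) - w (b i)) - (F (a i) - w (a i)))) < \<epsilon>"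
    proof (intro exI[of _ "min \<eta>1 \<eta>2"] conjI allI impI)
      fix n :: nat and a b :: "nat \<Rightarrow> real"
      assume ab: "\<forall>i<n. l \<le> a i \<and> a i \<le> b i \<and> b i \<le> u"
        and "disjoint_family_on (\<lambda>i. {a i<..<b i}) {..<n}" "(\<Sum>i<n. b i - a i) < min \<eta>1 \<eta>2"
      hence "(\<Sum>i<n. norm (w (b i) - w (a i))) < \<epsilon>/2" "(\<Sum>i<n. norm (F (b i) - F (a i))) < \<epsilon>/2"
        by (intro \<eta>1(2) \<eta>2(2); auto simp: interval_family_def)+
      moreover have "(\<Sum>i<n. norm ((F (b i) - w (b i)) - (F (a i) - w (a i)))) \<le>
          (\<Sum>i<n. norm (F (b i) - F (a i)) + norm (w (b i) - w (a i)))"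
        by (intro sum_mono) auto
      ultimately show "(\<Sum>i<n. norm ((F (b i) - w (b i)) - (F (a i) - w (a i)))) < \<epsilon>"
        by (simp add: sum.distrib)
    qed (use \<eta>1 \<eta>2 in auto)
  qed
  show ?thesis
  proof (rule that[OF _ _ acF acG])
    show "mono_on {l..u} F"
      using F_diff pos_variation_ge(2)[OF ac] by (intro mono_onI) (metis atLeastAtMost_iff diff_ge_0_iff_ge)
    show "mono_on {l..u} (\<lambda>x. F x - w x)"
    proof (intro mono_onI)
      fix r s assume "r \<in> {l..u}" "s \<in> {l..u}" "r \<le> s"
      thus "F r - w r \<le> F s - w s"
        using F_diff[of r s] pos_variation_ge(1)[OF ac, of r s] by auto
    qed
  qed simp
qed

section \<open>Absolutely continuous functions as indefinite integrals\<close>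

text \<open>The Stieltjes measure of a monotone absolutely continuous function vanishes on Lebesgue null
  sets, because these lie in open sets of small length; its Radon-Nikodym density is the integrand.\<close>

lemma abs_continuous_mono_density:
  fixes F :: "real \<Rightarrow> real"
  assumes ac: "abs_continuous_on_Icc l u F" and mono: "mono_on {l..u} F" and lu: "l \<le> u"
  obtains \<phi> :: "real \<Rightarrow> real" where "integrable lborel \<phi>"
    "\<And>a b. l \<le> a \<Longrightarrow> a \<le> b \<Longrightarrow> b \<le> u \<Longrightarrow> F b - F a = (\<integral>t\<in>{a..b}. \<phi> t \<partial>lborel)"
proof -
  \<comment> \<open>Extend \<open>F\<close> to the line by constants, so that it generates a Stieltjes measure.\<close>
  define cl where "cl = (\<lambda>x. max l (min u x))"
  have cl: "cl x \<in> {l..u}" "x \<le> y \<Longrightarrow> cl x \<le> cl y" "x \<in> {l..u} \<Longrightarrow> cl x = x" for x y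
    using lu by (auto simp: cl_def)
  have cl_lip: "x \<le> y \<Longrightarrow> cl y - cl x \<le> y - x" for x y
    using lu by (auto simp: cl_def)
  define H where "H = (\<lambda>x. F (cl x))"
  have H_mono: "x \<le> y \<Longrightarrow> H x \<le> H y" for x y
    using mono cl unfolding H_def mono_on_def by blast
  have acH: "\<exists>\<eta>>0. \<forall>I a b. finite I \<longrightarrow> (\<forall>i\<in>I. a i \<le> b i) \<longrightarrow>
      disjoint_family_on (\<lambda>i. {a i<..<b i}) I \<longrightarrow> (\<Sum>i\<in>(I::nat set). b i - a i) < \<eta> \<longrightarrow> (\<Sum>i\<in>I. H (b i) - H (a i)) < \<epsilon>"
    if e: "\<epsilon> > 0" for \<epsilon>
  proof -
    obtain \<eta> where \<eta>: "\<eta> > 0" "\<And>I a b. interval_family I a b l u \<Longrightarrow> (\<Sum>i\<in>I. b i - a i) < \<eta> \<Longrightarrow>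
       (\<Sum>i\<in>I. norm (F (b i) - F (a i))) < \<epsilon>"
      by (rule abs_continuous_on_IccD[OF ac e]) (rule that)
    show ?thesis
    proof (intro exI[of _ \<eta>] conjI allI impI \<eta>(1))
      fix I :: "nat set" and a b assume I: "finite I" "\<forall>i\<in>I. a i \<le> b i"
        "disjoint_family_on (\<lambda>i. {a i<..<b i}) I" "(\<Sum>i\<in>I. b i - a i) < \<eta>"
      have "interval_family I (\<lambda>i. cl (a i)) (\<lambda>i. cl (b i)) l u"
        unfolding interval_family_def
      proof (intro conjI ballI I(1))
        have "{cl (a i)<..<cl (b i)} \<subseteq> {a i<..<b i}" for i
          using lu by (auto simp: cl_def max_def min_def split: if_splits)
        thus "disjoint_family_on (\<lambda>i. {cl (a i)<..<cl (b i)}) I"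
          using I(3) unfolding disjoint_family_on_def by blast
      qed (use cl I in auto)
      moreover have "(\<Sum>i\<in>I. cl (b i) - cl (a i)) \<le> (\<Sum>i\<in>I. b i - a i)"
        using cl_lip I by (intro sum_mono) auto
      ultimately have "(\<Sum>i\<in>I. norm (F (cl (b i)) - F (cl (a i)))) < \<epsilon>"
        using I(4) by (intro \<eta>(2)) auto
      moreover have "(\<Sum>i\<in>I. H (b i) - H (a i)) \<le> (\<Sum>i\<in>I. norm (F (cl (b i)) - F (cl (a i))))"
        by (intro sum_mono) (auto simp: H_def)
      ultimately show "(\<Sum>i\<in>I. H (b i) - H (a i)) < \<epsilon>" by simp
    qed
  qed
  have H_cont: "isCont H x" for x
    unfolding continuous_at_eps_delta
  proof (intro allI impI)
    fix e :: real assume e: "e > 0"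
    then obtain \<eta> where \<eta>: "\<eta> > 0" "\<forall>I a b. finite I \<longrightarrow> (\<forall>i\<in>I. a i \<le> b i) \<longrightarrow>
      disjoint_family_on (\<lambda>i. {a i<..<b i}) I \<longrightarrow> (\<Sum>i\<in>(I::nat set). b i - a i) < \<eta> \<longrightarrow> (\<Sum>i\<in>I. H (b i) - H (a i)) < e"
      using acH[OF e] by (elim exE conjE) (rule that)
    have *: "H y - H x < e" if "x \<le> y" "y - x < \<eta>" for x y
      using \<eta>(2)[rule_format, of "{0}" "\<lambda>_. x" "\<lambda>_. y"] that by (auto simp: disjoint_family_on_def)
    show "\<exists>d>0. \<forall>x'. dist x' x < d \<longrightarrow> dist (H x') (H x) < e"
    proof (intro exI[of _ \<eta>] conjI allI impI \<eta>(1))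
      fix x' assume "dist x' x < \<eta>"
      thus "dist (H x') (H x) < e"
        using *[of x x'] *[of x' x] H_mono[of x x'] H_mono[of x' x]
        by (cases "x \<le> x'") (auto simp: dist_real_def)
    qed
  qed
  have H_rc: "continuous (at_right a) H" for a
    using H_cont continuous_at_imp_continuous_at_within by blast
  define M where "M = interval_measure H"
  have M_Ioc: "emeasure M {a<..b} = ennreal (H b - H a)" if "a \<le> b" for a b
    unfolding M_def using that H_mono H_rc by (rule emeasure_interval_measure_Ioc)
  have setsM[measurable_cong, simp]: "sets M = sets borel" and spaceM[simp]: "space M = UNIV" by (simp_all add: M_def)
  \<comment> \<open>An open set of small length is a countable disjoint union of open intervals, so absolute
    continuity bounds its Stieltjes measure.\<close>
  have M_small: "\<exists>\<eta>>0. \<forall>T. open T \<longrightarrow> emeasure lborel T < ennreal \<eta> \<longrightarrow> emeasure M T \<le> ennreal \<epsilon>"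
    if e: "\<epsilon> > 0" for \<epsilon>
  proof -
    obtain \<eta> where \<eta>: "\<eta> > 0" "\<forall>I a b. finite I \<longrightarrow> (\<forall>i\<in>I. a i \<le> b i) \<longrightarrow>
      disjoint_family_on (\<lambda>i. {a i<..<b i}) I \<longrightarrow> (\<Sum>i\<in>(I::nat set). b i - a i) < \<eta> \<longrightarrow> (\<Sum>i\<in>I. H (b i) - H (a i)) < \<epsilon>"
      using acH[OF e] by (elim exE conjE) (rule that)
    show ?thesis
    proof (intro exI[of _ \<eta>] conjI allI impI \<eta>(1))
      fix T :: "real set" assume T: "open T" "emeasure lborel T < ennreal \<eta>"
      have comp: "c = {Inf c<..<Sup c} \<and> Inf c < Sup c" if "c \<in> components T" for c
      proof -
        have "open c" "connected c" "c \<noteq> {}" "c \<subseteq> T"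
          using that T(1) open_components in_components_connected in_components_nonempty in_components_subset by blast+
        have ne: "emeasure lborel c < ennreal \<eta>"
          using emeasure_mono[OF \<open>c \<subseteq> T\<close>, of lborel] T by (auto intro: le_less_trans)
        have conv: "\<And>x y. x \<in> c \<Longrightarrow> y \<in> c \<Longrightarrow> {x..y} \<subseteq> c"
          using \<open>connected c\<close> connected_contains_Icc by blast
        obtain x0 where x0: "x0 \<in> c" using \<open>c \<noteq> {}\<close> by blast
        have bd: "\<bar>x - x0\<bar> \<le> \<eta>" if x: "x \<in> c" for x
        proof -
          have "{min x x0..max x x0} \<subseteq> c" using conv x x0 by (auto simp: min_def max_def)
          hence "emeasure lborel {min x x0..max x x0} \<le> emeasure lborel c" 
            using \<open>open c\<close> by (intro emeasure_mono) auto
          hence "ennreal (max x x0 - min x x0) < ennreal \<eta>" using ne by (simp add: le_less_trans)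
          thus ?thesis by (auto simp: ennreal_less_iff abs_real_def)
        qed
        have bb: "bdd_below c" "bdd_above c"
          using bd by (intro bdd_belowI[of _ "x0 - \<eta>"] bdd_aboveI[of _ "x0 + \<eta>"]; force)+
        have 1: "c \<subseteq> {Inf c<..<Sup c}"
        proof
          fix x assume x: "x \<in> c"
          then obtain d where d: "d > 0" "ball x d \<subseteq> c" using \<open>open c\<close> open_contains_ball by blast
          have "x - d/2 \<in> c" "x + d/2 \<in> c" using d by (auto simp: dist_real_def intro!: subsetD[OF d(2)])
          hence "Inf c \<le> x - d/2" "x + d/2 \<le> Sup c" using bb by (auto intro: cInf_lower cSup_upper)
          thus "x \<in> {Inf c<..<Sup c}" using d by auto
        qed
        have 2: "{Inf c<..<Sup c} \<subseteq> c"
        proof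
          fix x assume x: "x \<in> {Inf c<..<Sup c}"
          obtain y where "y \<in> c" "y < x" using x cInf_less_iff[OF \<open>c \<noteq> {}\<close> bb(1)] by auto
          moreover obtain z where "z \<in> c" "x < z" using x less_cSup_iff[OF \<open>c \<noteq> {}\<close> bb(2)] by auto
          ultimately show "x \<in> c" using conv[of y z] by auto
        qed
        have "Inf c < Sup c" using 1 x0 by auto
        thus ?thesis using 1 2 by auto
      qed
      have cnt: "countable (components T)"
      proof (rule countable_disjoint_open_subsets)
        show "open S" if "S \<in> components T" for S using open_components[OF T(1) that] .
        show "pairwise disjnt (components T)"
          using pairwise_disjoint_components[of T] by (simp add: pairwise_def disjnt_def)
      qed
      define f where "f = from_nat_into (insert {} (components T))"
      define A where "A = (\<lambda>n. \<Union> (components T \<inter> f ` {..<n}))"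
      have rangef: "range f = insert {} (components T)"
        unfolding f_def using cnt by (intro range_from_nat_into) auto
      have "(\<Union>n. A n) = T"
      proof -
        have "(\<Union>n. A n) = \<Union> (components T)"
        proof
          show "\<Union> (components T) \<subseteq> (\<Union>n. A n)"
          proof
            fix x assume "x \<in> \<Union> (components T)"
            then obtain c where c: "c \<in> components T" "x \<in> c" by blast
            then obtain k where "f k = c" using rangef by (metis insertI2 rangeE)
            hence "x \<in> A (Suc k)" using c unfolding A_def by blast
            thus "x \<in> (\<Union>n. A n)" by blast
          qed
        qed (unfold A_def, blast)
        thus ?thesis by (simp add: Union_components)
      qed
      moreover have incA: "incseq A" unfolding incseq_def A_def
        by (intro allI impI Union_mono Int_mono image_mono) auto
      moreover have Am: "A n \<in> sets borel" for n
        unfolding A_def by (intro borel_open open_Union ballI) (metis IntD1 T(1) open_components)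
      ultimately have lim: "(\<lambda>n. emeasure M (A n)) \<longlonglongrightarrow> emeasure M T"
        using Lim_emeasure_incseq[of A M] by (auto simp: image_subset_iff)
      have "emeasure M (A n) \<le> ennreal \<epsilon>" for n
      proof -
        define J where "J = components T \<inter> f ` {..<n}"
        have J: "finite J" "J \<subseteq> components T" by (auto simp: J_def)
        obtain h where h: "bij_betw h {..<card J} J"
          using ex_bij_betw_nat_finite[OF J(1)] by (auto simp: atLeast0LessThan)
        have hJ: "h i \<in> components T" if "i < card J" for i
          using bij_betwE[OF h] J(2) that by auto
        have dj: "disjoint_family_on h {..<card J}"
          unfolding disjoint_family_on_def
        proof (intro ballI impI)
          fix i j assume "i \<in> {..<card J}" "j \<in> {..<card J}" "i \<noteq> j"
          hence "h i \<in> components T" "h j \<in> components T" "h i \<noteq> h j"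
            using hJ bij_betw_imp_inj_on[OF h] by (auto dest: inj_onD)
          thus "h i \<inter> h j = {}" using components_nonoverlap by blast
        qed
        have AJ: "A n = (\<Union>i\<in>{..<card J}. h i)"
          using h unfolding A_def J_def[symmetric] bij_betw_def by auto
        have hb: "h i \<in> sets borel" if "i < card J" for i
          using hJ[OF that] T(1) open_components by (intro borel_open) blast
        define a where "a = (\<lambda>i. Inf (h i))"
        define b where "b = (\<lambda>i. Sup (h i))"
        have hab: "h i = {a i<..<b i}" "a i < b i" if "i < card J" for i
          using comp[OF hJ[OF that]] by (simp_all add: a_def b_def)
        have "ennreal (\<Sum>i<card J. b i - a i) = (\<Sum>i<card J. ennreal (b i - a i))"
          using hab(2) by (intro sum_ennreal[symmetric]) (auto intro: less_imp_le)
        also have "\<dots> = (\<Sum>i<card J. emeasure lborel (h i))"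
        proof (intro sum.cong refl)
          fix i assume "i \<in> {..<card J}"
          hence "h i = {a i<..<b i}" "a i \<le> b i" using hab[of i] by auto
          thus "ennreal (b i - a i) = emeasure lborel (h i)" by simp
        qed
        also have "\<dots> = emeasure lborel (A n)"
          unfolding AJ using dj hb by (intro sum_emeasure) auto
        also have "\<dots> \<le> emeasure lborel T"
        proof (rule emeasure_mono)
          show "A n \<subseteq> T" unfolding A_def using Union_components[of T] by blast
        qed (use T(1) in auto)
        also have "\<dots> < ennreal \<eta>" by fact
        finally have "(\<Sum>i<card J. b i - a i) < \<eta>"
          using \<eta>(1) ennreal_less_iff[of "\<Sum>i<card J. b i - a i"] hab(2) sum_nonneg[of "{..<card J}" "\<lambda>i. b i - a i"]
          by (auto intro: less_imp_le)
        moreover have "disjoint_family_on (\<lambda>i. {a i<..<b i}) {..<card J}"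
          using dj hab(1) unfolding disjoint_family_on_def by auto
        ultimately have less: "(\<Sum>i<card J. H (b i) - H (a i)) < \<epsilon>"
          using hab(2) by (intro \<eta>(2)[rule_format]) (auto intro: less_imp_le)
        have "emeasure M (A n) = (\<Sum>i<card J. emeasure M (h i))"
          unfolding AJ using dj hb by (intro sum_emeasure[symmetric]) auto
        also have "\<dots> \<le> (\<Sum>i<card J. ennreal (H (b i) - H (a i)))"
        proof (intro sum_mono)
          fix i assume i: "i \<in> {..<card J}"
          have "emeasure M (h i) \<le> emeasure M {a i<..b i}"
            using hab[of i] i by (intro emeasure_mono) auto
          thus "emeasure M (h i) \<le> ennreal (H (b i) - H (a i))"
            using M_Ioc[of "a i" "b i"] hab(2)[of i] i by auto
        qed
        also have "\<dots> = ennreal (\<Sum>i<card J. H (b i) - H (a i))"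
          using H_mono hab(2) by (intro sum_ennreal) (auto intro: less_imp_le)
        also have "\<dots> \<le> ennreal \<epsilon>" using less by (intro ennreal_leI) simp
        finally show ?thesis .
      qed
      thus "emeasure M T \<le> ennreal \<epsilon>" using LIMSEQ_le_const2[OF lim] by blast
    qed
  qed
  have "absolutely_continuous lborel M"
    unfolding absolutely_continuous_def
  proof
    fix Z :: "real set" assume Z: "Z \<in> null_sets lborel"
    have small: "emeasure M Z \<le> ennreal \<epsilon>" if e: "\<epsilon> > 0" for \<epsilon>
    proof -
      obtain \<eta> where \<eta>: "\<eta> > 0" "\<forall>T. open T \<longrightarrow> emeasure lborel T < ennreal \<eta> \<longrightarrow> emeasure M T \<le> ennreal \<epsilon>"
        using M_small[OF e] by blast
      obtain T where T: "open T" "Z \<subseteq> T" "emeasure lborel (T - Z) < ennreal \<eta>"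
        using outer_regular_lborel[of Z \<eta>] Z \<eta>(1) by (auto simp: null_sets_def)
      have "emeasure lborel T = emeasure lborel (T - Z)"
        using Z T by (subst emeasure_Diff_null_set) auto
      hence "emeasure M T \<le> ennreal \<epsilon>" using T \<eta>(2) by auto
      moreover have "emeasure M Z \<le> emeasure M T" using T by (intro emeasure_mono) auto
      ultimately show ?thesis by simp
    qed
    have "emeasure M Z \<le> 0"
    proof (rule ennreal_le_epsilon)
      show "emeasure M Z \<le> 0 + ennreal e" if "0 < e" for e using small[OF that] by simp
    qed
    thus "Z \<in> null_sets M" using Z by (auto simp: null_sets_def)
  qed
  then obtain f where f: "f \<in> borel_measurable lborel" "density lborel f = M"
    using sigma_finite_measure.Radon_Nikodym[OF lborel.sigma_finite_measure_axioms, of M] by auto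
  have [measurable]: "f \<in> borel_measurable borel" using f(1) by simp
  \<comment> \<open>The density is finite almost everywhere on the interval, which justifies \<open>enn2real\<close>.\<close>
  define \<phi> where "\<phi> = (\<lambda>x. indicator {l..u} x * enn2real (f x))"
  have fM: "(\<integral>\<^sup>+t. f t * indicator {a<..b} t \<partial>lborel) = ennreal (H b - H a)" if "a \<le> b" for a b
  proof -
    have "emeasure (density lborel f) {a<..b} = (\<integral>\<^sup>+t. f t * indicator {a<..b} t \<partial>lborel)"
      by (intro emeasure_density) auto
    thus ?thesis using f(2) M_Ioc[OF that] by simp
  qed
  have ffin: "AE t in lborel. t \<in> {l<..u} \<longrightarrow> f t \<noteq> \<infinity>"
  proof -
    have "AE t in lborel. f t * indicator {l<..u} t \<noteq> \<infinity>"
      using fM[OF lu] by (intro nn_integral_noteq_infinite) auto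
    thus ?thesis by eventually_elim (auto simp: indicator_def)
  qed
  have nl: "AE t in lborel. t \<noteq> c" for c :: real by (rule AE_lborel_singleton)
  have nn: "(\<integral>\<^sup>+t. ennreal (indicator {a..b} t * \<phi> t) \<partial>lborel) = ennreal (F b - F a)" if ab: "l \<le> a" "a \<le> b" "b \<le> u" for a b
  proof -
    have "(\<integral>\<^sup>+t. ennreal (indicator {a..b} t * \<phi> t) \<partial>lborel) = (\<integral>\<^sup>+t. f t * indicator {a<..b} t \<partial>lborel)"
    proof (rule nn_integral_cong_AE)
      show "AE t in lborel. ennreal (indicator {a..b} t * \<phi> t) = f t * indicator {a<..b} t"
        using ffin nl[of a] by eventually_elim (use ab in \<open>auto simp: \<phi>_def indicator_def less_top\<close>)
    qed
    also have "\<dots> = ennreal (H b - H a)" by (rule fM) fact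
    also have "\<dots> = ennreal (F b - F a)" using cl(3) ab by (auto simp: H_def)
    finally show ?thesis .
  qed
  have \<phi>_nn: "0 \<le> \<phi> x" for x by (auto simp: \<phi>_def)
  have [measurable]: "\<phi> \<in> borel_measurable borel" unfolding \<phi>_def by measurable
  have int: "integrable lborel \<phi>"
  proof (rule integrableI_nonneg)
    have supp: "indicator {l..u} t * \<phi> t = \<phi> t" for t by (auto simp: \<phi>_def indicator_def)
    show "(\<integral>\<^sup>+t. ennreal (\<phi> t) \<partial>lborel) < \<infinity>" using nn[of l u, unfolded supp] lu by simp
  qed (auto simp: \<phi>_nn)
  show ?thesis
  proof (rule that[OF int])
    fix a b assume ab: "l \<le> a" "a \<le> b" "b \<le> u"
    have i: "integrable lborel (\<lambda>t. indicator {a..b} t *\<^sub>R \<phi> t)" by (intro integrable_mult_indicator int) auto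
    have "F a \<le> F b" using mono_onD[OF mono, of a b] ab by auto
    have "ennreal (\<integral>t. indicator {a..b} t *\<^sub>R \<phi> t \<partial>lborel) = ennreal (F b - F a)"
      using nn[OF ab] by (subst nn_integral_eq_integral[OF i, symmetric]) (auto simp: \<phi>_nn)
    moreover have "0 \<le> (\<integral>t. indicator {a..b} t *\<^sub>R \<phi> t \<partial>lborel)" by (intro integral_nonneg_AE) (auto simp: \<phi>_nn)
    ultimately show "F b - F a = (\<integral>t\<in>{a..b}. \<phi> t \<partial>lborel)"
      using \<open>F a \<le> F b\<close> unfolding set_lebesgue_integral_def by (simp add: ennreal_inj)
  qed
qed

text \<open>Real and imaginary part, and in each of them the two monotone parts, are treated separately.\<close>

theorem abs_continuous_on_Icc_density:
  fixes w :: "real \<Rightarrow> complex"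
  assumes ac: "abs_continuous_on_Icc l u w" and lu: "l \<le> u"
  obtains \<phi> :: "real \<Rightarrow> complex" where "integrable lborel \<phi>"
    "\<And>a b. l \<le> a \<Longrightarrow> a \<le> b \<Longrightarrow> b \<le> u \<Longrightarrow> w b - w a = (\<integral>t\<in>{a..b}. \<phi> t \<partial>lborel)"
proof -
  have real: "\<exists>\<phi>::real\<Rightarrow>real. integrable lborel \<phi> \<and>
      (\<forall>a b. l \<le> a \<longrightarrow> a \<le> b \<longrightarrow> b \<le> u \<longrightarrow> v b - v a = (\<integral>t\<in>{a..b}. \<phi> t \<partial>lborel))"
    if acv: "abs_continuous_on_Icc l u v" for v :: "real \<Rightarrow> real"
  proof -
    obtain F G where FG: "mono_on {l..u} F" "mono_on {l..u} G"
      "abs_continuous_on_Icc l u F" "abs_continuous_on_Icc l u G" "\<And>x. v x = F x - G x"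
      using abs_continuous_on_Icc_decompose[OF acv lu] by blast
    obtain \<phi> where \<phi>: "integrable lborel \<phi>"
      "\<And>a b. l \<le> a \<Longrightarrow> a \<le> b \<Longrightarrow> b \<le> u \<Longrightarrow> F b - F a = (\<integral>t\<in>{a..b}. \<phi> t \<partial>lborel)"
      using abs_continuous_mono_density[OF FG(3,1) lu] by blast
    obtain \<gamma> where \<gamma>: "integrable lborel \<gamma>"
      "\<And>a b. l \<le> a \<Longrightarrow> a \<le> b \<Longrightarrow> b \<le> u \<Longrightarrow> G b - G a = (\<integral>t\<in>{a..b}. \<gamma> t \<partial>lborel)"
      using abs_continuous_mono_density[OF FG(4,2) lu] by blast
    have "v b - v a = (\<integral>t\<in>{a..b}. \<phi> t - \<gamma> t \<partial>lborel)" if "l \<le> a" "a \<le> b" "b \<le> u" for a b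
    proof -
      have "(\<integral>t\<in>{a..b}. \<phi> t - \<gamma> t \<partial>lborel) = (\<integral>t\<in>{a..b}. \<phi> t \<partial>lborel) - (\<integral>t\<in>{a..b}. \<gamma> t \<partial>lborel)"
        by (rule set_integral_diff(2); unfold set_integrable_def; intro integrable_mult_indicator \<phi>(1) \<gamma>(1)) auto
      thus ?thesis using \<phi>(2)[OF that] \<gamma>(2)[OF that] FG(5) by simp
    qed
    thus ?thesis using \<phi>(1) \<gamma>(1) by (intro exI[of _ "\<lambda>t. \<phi> t - \<gamma> t"]) auto
  qed
  have proj: "abs_continuous_on_Icc l u (\<lambda>x. P (w x))"
    if P: "\<And>x y. \<bar>P x - P y\<bar> \<le> norm (x - y)" for P :: "complex \<Rightarrow> real"
    unfolding abs_continuous_on_Icc_def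
  proof (intro allI impI)
    fix \<epsilon> :: real assume e: "\<epsilon> > 0"
    obtain \<eta> where \<eta>: "\<eta> > 0" "\<And>I a b. interval_family I a b l u \<Longrightarrow> (\<Sum>i\<in>I. b i - a i) < \<eta> \<Longrightarrow>
       (\<Sum>i\<in>I. norm (w (b i) - w (a i))) < \<epsilon>"
      by (rule abs_continuous_on_IccD[OF ac e]) (rule that)
    show "\<exists>\<eta>>0. \<forall>(n::nat) a b. (\<forall>i<n. l \<le> a i \<and> a i \<le> b i \<and> b i \<le> u) \<longrightarrow>
        disjoint_family_on (\<lambda>i. {a i<..<b i}) {..<n} \<longrightarrow>
        (\<Sum>i<n. b i - a i) < \<eta> \<longrightarrow> (\<Sum>i<n. norm (P (w (b i)) - P (w (a i)))) < \<epsilon>"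
    proof (intro exI[of _ \<eta>] conjI allI impI \<eta>(1))
      fix n :: nat and a b :: "nat \<Rightarrow> real"
      assume "\<forall>i<n. l \<le> a i \<and> a i \<le> b i \<and> b i \<le> u"
        "disjoint_family_on (\<lambda>i. {a i<..<b i}) {..<n}" "(\<Sum>i<n. b i - a i) < \<eta>"
      hence "(\<Sum>i<n. norm (w (b i) - w (a i))) < \<epsilon>"
        by (intro \<eta>(2)) (auto simp: interval_family_def)
      moreover have "(\<Sum>i<n. norm (P (w (b i)) - P (w (a i)))) \<le> (\<Sum>i<n. norm (w (b i) - w (a i)))"
        by (intro sum_mono) (auto intro: P)
      ultimately show "(\<Sum>i<n. norm (P (w (b i)) - P (w (a i)))) < \<epsilon>" by simp
    qed
  qed
  obtain \<phi>1 :: "real \<Rightarrow> real" where 1: "integrable lborel \<phi>1"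
     "\<And>a b. l \<le> a \<Longrightarrow> a \<le> b \<Longrightarrow> b \<le> u \<Longrightarrow> Re (w b) - Re (w a) = (\<integral>t\<in>{a..b}. \<phi>1 t \<partial>lborel)"
    using real[OF proj[of Re]] by (metis abs_Re_le_cmod minus_complex.simps(1))
  obtain \<phi>2 :: "real \<Rightarrow> real" where 2: "integrable lborel \<phi>2"
     "\<And>a b. l \<le> a \<Longrightarrow> a \<le> b \<Longrightarrow> b \<le> u \<Longrightarrow> Im (w b) - Im (w a) = (\<integral>t\<in>{a..b}. \<phi>2 t \<partial>lborel)"
    using real[OF proj[of Im]] by (metis abs_Im_le_cmod minus_complex.simps(2))
  show ?thesis
  proof (rule that[of "\<lambda>t. Complex (\<phi>1 t) (\<phi>2 t)"])
    show int: "integrable lborel (\<lambda>t. Complex (\<phi>1 t) (\<phi>2 t))"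
      unfolding Complex_eq using 1(1) 2(1) by (intro Bochner_Integration.integrable_add integrable_mult_right integrable_of_real)
    fix a b assume ab: "l \<le> a" "a \<le> b" "b \<le> u"
    have i: "integrable lborel (\<lambda>t. indicator {a..b} t *\<^sub>R Complex (\<phi>1 t) (\<phi>2 t))"
      by (intro integrable_mult_indicator int) auto
    show "w b - w a = (\<integral>t\<in>{a..b}. Complex (\<phi>1 t) (\<phi>2 t) \<partial>lborel)"
      using 1(2)[OF ab] 2(2)[OF ab] integral_Re[OF i] integral_Im[OF i]
      by (intro complex_eqI) (simp_all add: set_lebesgue_integral_def)
  qed
qed

section \<open>Absolutely continuous functions on the circle\<close>

lemma AE_lborel_shift:
  fixes P :: "real \<Rightarrow> bool"
  assumes "AE x in lborel. P x"
  shows "AE x in lborel. P (x + c)"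
proof -
  obtain N where N: "{x \<in> space lborel. \<not> P x} \<subseteq> N" "emeasure lborel N = 0" "N \<in> sets lborel"
    using AE_E[OF assms] by blast
  have "AE x in lborel. x \<notin> N" using N by (intro AE_not_in) (auto simp: null_sets_def)
  hence "AE x in lborel. c + 1 * x \<notin> N"
    using N(3) by (intro AE_borel_affine) auto
  thus ?thesis using N(1) by (auto simp: add.commute elim!: eventually_mono)
qed

lemma periodic_2pi_int:
  assumes "periodic_2pi f"
  shows "f (x + 2 * pi * of_int j) = f x"
proof -
  have nat: "f (y + 2 * pi * of_nat n) = f y" for y n
  proof (induction n)
    case (Suc n)
    have "f (y + 2 * pi * of_nat (Suc n)) = f ((y + 2 * pi * of_nat n) + 2 * pi)" by (simp add: algebra_simps)
    also have "\<dots> = f y" using assms Suc by (simp add: periodic_2pi_def)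
    finally show ?case .
  qed simp
  show ?thesis
  proof (cases "j \<ge> 0")
    case True
    thus ?thesis using nat[of x "nat j"] by simp
  next
    case False
    thus ?thesis using nat[of "x + 2 * pi * of_int j" "nat (- j)"] by simp
  qed
qed

text \<open>The line is covered by countably many translates of the period and the null set of its end points.\<close>

lemma AE_lborel_from_period:
  fixes P :: "real \<Rightarrow> bool"
  assumes AE: "AE x in lborel. 0 < x \<longrightarrow> x < 2 * pi \<longrightarrow> P x"
    and per: "periodic_2pi P"
  shows "AE x in lborel. P x"
proof -
  have "AE x in lborel. \<forall>j::int. 0 < x + 2 * pi * of_int j \<longrightarrow> x + 2 * pi * of_int j < 2 * pi \<longrightarrow> P x"
    unfolding AE_all_countable
  proof
    fix j :: int
    show "AE x in lborel. 0 < x + 2 * pi * of_int j \<longrightarrow> x + 2 * pi * of_int j < 2 * pi \<longrightarrow> P x"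
      using AE_lborel_shift[OF AE, of "2 * pi * of_int j"] by (simp only: periodic_2pi_int[OF per])
  qed
  moreover have "AE x in lborel. \<forall>j::int. x \<noteq> 2 * pi * of_int j"
    unfolding AE_all_countable by (intro allI AE_lborel_singleton)
  ultimately show ?thesis
  proof eventually_elim
    fix x assume *: "\<forall>j::int. 0 < x + 2 * pi * of_int j \<longrightarrow> x + 2 * pi * of_int j < 2 * pi \<longrightarrow> P x"
      and **: "\<forall>j::int. x \<noteq> 2 * pi * of_int j"
    define j where "j = \<lfloor>x / (2 * pi)\<rfloor>"
    have "of_int j \<le> x / (2 * pi)" "x / (2 * pi) < of_int j + 1" by (simp_all add: j_def)
    hence "2 * pi * of_int j \<le> x" "x < 2 * pi * of_int j + 2 * pi" by (simp_all add: field_simps)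
    thus "P x" using *[rule_format, of "- j"] **[rule_format, of j] by auto
  qed
qed

text \<open>Half-open intervals, so that adjacent intervals are disjoint and the integrals simply add up.\<close>

definition primitive :: "(real \<Rightarrow> complex) \<Rightarrow> (real \<Rightarrow> complex) \<Rightarrow> bool" where
  "primitive w g \<longleftrightarrow> g \<in> borel_measurable borel \<and>
     (\<forall>a b. a \<le> b \<longrightarrow> set_integrable lborel {a<..b} g \<and> w b - w a = (\<integral>t\<in>{a<..b}. g t \<partial>lborel))"

lemma set_integrable_shift:
  fixes g :: "real \<Rightarrow> complex"
  shows "set_integrable lborel {a<..b} (\<lambda>x. g (x + c)) \<longleftrightarrow> set_integrable lborel {a + c<..b + c} g"
    and "(\<integral>t\<in>{a<..b}. g (t + c) \<partial>lborel) = (\<integral>t\<in>{a + c<..b + c}. g t \<partial>lborel)"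
proof -
  have eq: "(indicator {a + c<..b + c} (c + 1 * x) :: real) *\<^sub>R g (c + 1 * x) = indicator {a<..b} x *\<^sub>R g (x + c)" for x
    by (simp add: indicator_def add.commute)
  show "set_integrable lborel {a<..b} (\<lambda>x. g (x + c)) \<longleftrightarrow> set_integrable lborel {a + c<..b + c} g"
    unfolding set_integrable_def
    using lborel_integrable_real_affine_iff[of 1 "\<lambda>x. indicator {a + c<..b + c} x *\<^sub>R g x" c] unfolding eq by simp
  show "(\<integral>t\<in>{a<..b}. g (t + c) \<partial>lborel) = (\<integral>t\<in>{a + c<..b + c}. g t \<partial>lborel)"
    unfolding set_lebesgue_integral_def
    using lborel_integral_real_affine[of 1 "\<lambda>x. indicator {a + c<..b + c} x *\<^sub>R g x" c] unfolding eq by simp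
qed

lemma primitive_shift:
  assumes "primitive w g"
  shows "primitive (\<lambda>x. w (x + c)) (\<lambda>x. g (x + c))"
  using assms unfolding primitive_def by (auto simp: set_integrable_shift)

lemma primitive_diff:
  assumes "primitive w g" "primitive v f"
  shows "primitive (\<lambda>x. w x - v x) (\<lambda>x. g x - f x)"
  using assms unfolding primitive_def
  by (auto simp: set_integral_diff algebra_simps)

text \<open>The fundamental theorem of calculus for absolutely continuous functions on the circle. The
  derivative exists only almost everywhere, so it is replaced by a Borel function that is periodic and
  agrees with it almost everywhere.\<close>

theorem AC_circle_derivative:
  assumes "w \<in> AC_circle"
  obtains g where "periodic_2pi g" "primitive w g" "AE x in lborel. vector_derivative w (at x) = g x"
proof -
  have per: "periodic_2pi w" and ac: "abs_continuous_on_Icc 0 (2 * pi) w"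
    using assms by (auto simp: AC_circle_def)
  obtain \<phi> where \<phi>: "integrable lborel \<phi>"
    "\<And>a b. 0 \<le> a \<Longrightarrow> a \<le> b \<Longrightarrow> b \<le> 2 * pi \<Longrightarrow> w b - w a = (\<integral>t\<in>{a..b}. \<phi> t \<partial>lborel)"
    using abs_continuous_on_Icc_density[OF ac] by auto
  have [measurable]: "\<phi> \<in> borel_measurable borel" using \<phi>(1) by auto
  \<comment> \<open>The periodic extension of the density from \<open>[0, 2\<pi>)\<close>.\<close>
  define g where "g = (\<lambda>x. \<phi> (x - 2 * pi * of_int \<lfloor>x / (2 * pi)\<rfloor>))"
  have [measurable]: "g \<in> borel_measurable borel" unfolding g_def by measurable
  have perg: "periodic_2pi g"
    by (simp add: periodic_2pi_def g_def add_divide_distrib algebra_simps)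
  have g_eq: "g x = \<phi> x" if "0 \<le> x" "x < 2 * pi" for x
  proof -
    have "\<lfloor>x / (2 * pi)\<rfloor> = 0" using that by (simp add: floor_eq_iff)
    thus ?thesis by (simp add: g_def)
  qed
  \<comment> \<open>The fundamental theorem on \<open>(a, b]\<close>: first inside one period, then over any number of periods.\<close>
  define FT where "FT = (\<lambda>a b. set_integrable lborel {a<..b} g \<and> w b - w a = (\<integral>t\<in>{a<..b}. g t \<partial>lborel))"
  have FT0: "FT a b" if ab: "0 \<le> a" "a \<le> b" "b \<le> 2 * pi" for a b
  proof -
    have AE: "AE t in lborel. indicator {a<..b} t *\<^sub>R g t = indicator {a..b} t *\<^sub>R \<phi> t"
      using AE_lborel_singleton[of a] AE_lborel_singleton[of "2 * pi"]
      by eventually_elim (use ab g_eq in \<open>auto simp: indicator_def\<close>)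
    have "integrable lborel (\<lambda>t. indicator {a..b} t *\<^sub>R \<phi> t)" by (intro integrable_mult_indicator \<phi>(1)) auto
    hence "set_integrable lborel {a<..b} g"
      unfolding set_integrable_def using AE by (subst integrable_cong_AE) auto
    moreover have "(\<integral>t\<in>{a<..b}. g t \<partial>lborel) = (\<integral>t\<in>{a..b}. \<phi> t \<partial>lborel)"
      unfolding set_lebesgue_integral_def using AE by (intro integral_cong_AE) auto
    ultimately show ?thesis unfolding FT_def using \<phi>(2)[OF ab] by simp
  qed
  have FT1: "FT a b" if ab: "2 * pi * of_int j \<le> a" "a \<le> b" "b \<le> 2 * pi * of_int j + 2 * pi" for a b and j :: int
  proof -
    define c where "c = - (2 * pi * of_int j)"
    have gper: "g (t + c) = g t" for t using periodic_2pi_int[OF perg, of t "- j"] by (simp add: c_def)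
    have wper: "w (t + c) = w t" for t using periodic_2pi_int[OF per, of t "- j"] by (simp add: c_def)
    have "FT (a + c) (b + c)" using ab by (intro FT0) (auto simp: c_def)
    thus ?thesis
      using set_integrable_shift[of a b g c] unfolding FT_def gper wper by simp
  qed
  have FT_trans: "FT a c" if "FT a b" "FT b c" "a \<le> b" "b \<le> c" for a b c
  proof -
    have "{a<..c} = {a<..b} \<union> {b<..c}" using that by auto
    thus ?thesis using that set_integrable_Un[of lborel "{a<..b}" g "{b<..c}"]
        set_integral_Un[of "{a<..b}" "{b<..c}" lborel g]
      unfolding FT_def by (auto simp: algebra_simps)
  qed
  have FT_n: "FT a b" if "2 * pi * of_int j \<le> a" "a \<le> 2 * pi * of_int j + 2 * pi" "a \<le> b" "b \<le> 2 * pi * of_int j + 2 * pi * real (Suc n)"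
    for a b n and j :: int
    using that
  proof (induction n arbitrary: a j)
    case 0
    thus ?case by (intro FT1[of j]) auto
  next
    case (Suc n)
    define c where "c = 2 * pi * of_int j + 2 * pi"
    show ?case
    proof (cases "b \<le> c")
      case True
      thus ?thesis using Suc.prems by (intro FT1[of j]) (auto simp: c_def)
    next
      case False
      have "FT a c" using Suc.prems by (intro FT1[of j]) (auto simp: c_def)
      moreover have "FT c b"
        using Suc.prems False by (intro Suc.IH[of "j + 1"]) (auto simp: c_def algebra_simps)
      ultimately show ?thesis using FT_trans Suc.prems False by (auto simp: c_def)
    qed
  qed
  have FT: "FT a b" if "a \<le> b" for a b
  proof -
    define j where "j = \<lfloor>a / (2 * pi)\<rfloor>"
    have "of_int j \<le> a / (2 * pi)" "a / (2 * pi) < of_int j + 1" by (simp_all add: j_def)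
    hence j: "2 * pi * of_int j \<le> a" "a < 2 * pi * of_int j + 2 * pi" by (simp_all add: field_simps)
    obtain n where "b - 2 * pi * of_int j < 2 * pi * real n" using reals_Archimedean3[of "2 * pi"]
      by (auto simp: mult.commute)
    hence "b \<le> 2 * pi * of_int j + 2 * pi * real (Suc n)"
      using pi_gt_zero by (simp only: of_nat_Suc distrib_left)
    thus ?thesis using FT_n[of j a b n] j that by auto
  qed
  have prim: "primitive w g" unfolding primitive_def using FT by (auto simp: FT_def)
  have "AE x in lborel. (w has_vector_derivative g x) (at x)"
  proof (rule AE_lborel_from_period)
    show "AE x in lborel. 0 < x \<longrightarrow> x < 2 * pi \<longrightarrow> (w has_vector_derivative g x) (at x)"
      using AE_has_vector_derivative_indefinite_integral[OF \<phi>(1), of 0 "2 * pi" w] \<phi>(2)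
      by (auto simp: g_eq elim!: eventually_mono)
    have sh: "(w has_vector_derivative D) (at x)" if "(w has_vector_derivative D) (at (x + c))" "\<And>x. w (x + c) = w x" for D x c
    proof -
      have "((\<lambda>y. y + c) has_vector_derivative 1) (at x)"
        by (auto intro!: derivative_eq_intros)
      from vector_diff_chain_at[OF this that(1)] show ?thesis using that(2) by (simp add: o_def)
    qed
    have wp: "w (x + 2 * pi) = w x" "w (x + (- (2 * pi))) = w x" for x
      using per spec[OF per[unfolded periodic_2pi_def], of "x - 2 * pi"] by (auto simp: periodic_2pi_def)
    have "(w has_vector_derivative D) (at (x + 2 * pi)) \<longleftrightarrow> (w has_vector_derivative D) (at x)" for D x
      using sh[of D x "2 * pi"] sh[of D "x + 2 * pi" "- (2 * pi)"] wp by auto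
    thus "periodic_2pi (\<lambda>x. (w has_vector_derivative g x) (at x))"
      using perg by (simp add: periodic_2pi_def)
  qed
  hence "AE x in lborel. vector_derivative w (at x) = g x"
    by eventually_elim (rule vector_derivative_at)
  thus ?thesis using perg prim that by blast
qed

section \<open>Finite differences\<close>

lemma finite_diff_zero [simp]: "finite_diff 0 h f = f"
  by (simp add: finite_diff_def fun_eq_iff)

lemma finite_diff_Suc:
  "finite_diff (Suc s) h f x = finite_diff s h f x - finite_diff s h f (x + h)"
proof -
  define a where "a = (\<lambda>\<nu>. (-1) ^ \<nu> * f (x + real \<nu> * h))"
  have "finite_diff (Suc s) h f x = (\<Sum>\<nu>=0..Suc s. of_nat (Suc s choose \<nu>) * a \<nu>)"
    by (simp add: finite_diff_def a_def mult.assoc)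
  also have "\<dots> = a 0 + (\<Sum>\<nu>=0..s. of_nat (Suc s choose Suc \<nu>) * a (Suc \<nu>))"
    by (subst sum.atLeast0_atMost_Suc_shift) simp
  also have "(\<Sum>\<nu>=0..s. of_nat (Suc s choose Suc \<nu>) * a (Suc \<nu>)) =
      (\<Sum>\<nu>=0..s. of_nat (s choose Suc \<nu>) * a (Suc \<nu>)) + (\<Sum>\<nu>=0..s. of_nat (s choose \<nu>) * a (Suc \<nu>))"
    by (simp add: sum.distrib[symmetric] algebra_simps)
  also have "a 0 + ((\<Sum>\<nu>=0..s. of_nat (s choose Suc \<nu>) * a (Suc \<nu>)) + (\<Sum>\<nu>=0..s. of_nat (s choose \<nu>) * a (Suc \<nu>))) =
      (\<Sum>\<nu>=0..Suc s. of_nat (s choose \<nu>) * a \<nu>) + (\<Sum>\<nu>=0..s. of_nat (s choose \<nu>) * a (Suc \<nu>))"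
    by (subst sum.atLeast0_atMost_Suc_shift) (simp add: add.assoc)
  also have "(\<Sum>\<nu>=0..Suc s. of_nat (s choose \<nu>) * a \<nu>) = finite_diff s h f x"
    by (simp add: finite_diff_def a_def mult.assoc)
  also have "(\<Sum>\<nu>=0..s. of_nat (s choose \<nu>) * a (Suc \<nu>)) = - finite_diff s h f (x + h)"
    unfolding finite_diff_def sum_negf[symmetric]
    by (intro sum.cong) (auto simp: a_def algebra_simps)
  finally show ?thesis by simp
qed

lemma finite_diff_add: "finite_diff (a + b) h f = finite_diff a h (finite_diff b h f)"
proof (induction a)
  case (Suc a)
  show ?case by (rule ext) (simp add: finite_diff_Suc Suc.IH)
qed simp

lemma finite_diff_of_diff:
  "finite_diff m t (\<lambda>x. u x - v x) x = finite_diff m t u x - finite_diff m t v x"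
  by (simp add: finite_diff_def sum_subtractf[symmetric] algebra_simps)

lemma finite_diff_of_shift:
  "finite_diff m t (\<lambda>x. u (x + c)) x = finite_diff m t u (x + c)"
  by (simp add: finite_diff_def algebra_simps)

lemma finite_diff_commute: "finite_diff m t (finite_diff k h g) = finite_diff k h (finite_diff m t g)"
proof (induction k)
  case (Suc k)
  have "finite_diff m t (finite_diff (Suc k) h g) x = finite_diff (Suc k) h (finite_diff m t g) x" for x
  proof -
    have "finite_diff (Suc k) h g = (\<lambda>x. finite_diff k h g x - finite_diff k h g (x + h))"
      by (rule ext) (rule finite_diff_Suc)
    hence "finite_diff m t (finite_diff (Suc k) h g) x = finite_diff m t (finite_diff k h g) x - finite_diff m t (finite_diff k h g) (x + h)"
      by (simp add: finite_diff_of_diff finite_diff_of_shift[of m t "finite_diff k h g"])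
    thus ?thesis by (simp add: Suc.IH finite_diff_Suc)
  qed
  thus ?case by blast
qed simp

lemma finite_diff_periodic: "periodic_2pi G \<Longrightarrow> periodic_2pi (finite_diff m t G)"
proof -
  assume per: "periodic_2pi G"
  have "G (x + 2 * pi + s) = G (x + s)" for x s
    using spec[OF per[unfolded periodic_2pi_def], of "x + s"] by (simp add: algebra_simps)
  thus ?thesis by (simp add: periodic_2pi_def finite_diff_def)
qed

lemma borel_measurable_finite_diff[measurable (raw)]:
  assumes [measurable]: "G \<in> borel_measurable borel" "t \<in> borel_measurable M" "y \<in> borel_measurable M"
  shows "(\<lambda>x. finite_diff m (t x) G (y x)) \<in> borel_measurable M"
  unfolding finite_diff_def by measurable

lemma norm_le_finite_diff_plus_translates:
  "norm (f x) \<le> norm (finite_diff m t f x) + (\<Sum>\<nu>=1..m. real (m choose \<nu>) * norm (f (x + real \<nu> * t)))"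
proof -
  have "finite_diff m t f x = f x + (\<Sum>\<nu>=1..m. of_nat (m choose \<nu>) * (-1) ^ \<nu> * f (x + real \<nu> * t))"
    unfolding finite_diff_def by (subst sum.atLeast_Suc_atMost) auto
  hence "f x = finite_diff m t f x - (\<Sum>\<nu>=1..m. of_nat (m choose \<nu>) * (-1) ^ \<nu> * f (x + real \<nu> * t))" by simp
  also have "norm \<dots> \<le> norm (finite_diff m t f x) + norm (\<Sum>\<nu>=1..m. of_nat (m choose \<nu>) * (-1) ^ \<nu> * f (x + real \<nu> * t))"
    by (rule norm_triangle_ineq4)
  also have "norm (\<Sum>\<nu>=1..m. of_nat (m choose \<nu>) * (-1) ^ \<nu> * f (x + real \<nu> * t)) \<le> (\<Sum>\<nu>=1..m. real (m choose \<nu>) * norm (f (x + real \<nu> * t)))"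
    by (rule sum_norm_le) (auto simp: norm_mult norm_power)
  finally show ?thesis by simp
qed

lemma primitive_finite_diff:
  "primitive w g \<Longrightarrow> primitive (finite_diff k h w) (finite_diff k h g)"
proof (induction k)
  case (Suc k)
  have "finite_diff (Suc k) h v = (\<lambda>x. finite_diff k h v x - finite_diff k h v (x + h))" for v
    by (rule ext) (rule finite_diff_Suc)
  thus ?case using primitive_diff[OF Suc.IH primitive_shift[OF Suc.IH, of h]] Suc.prems by simp
qed simp

lemma has_vector_derivative_finite_diff:
  assumes "\<And>x. (u has_vector_derivative v x) (at x)"
  shows "(finite_diff k h u has_vector_derivative finite_diff k h v x) (at x)"
proof -
  have "((\<lambda>y. u (y + c)) has_vector_derivative v (x + c)) (at x)" for c
  proof -
    have "((\<lambda>y. y + c) has_vector_derivative 1) (at x)" by (auto intro!: derivative_eq_intros)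
    from vector_diff_chain_at[OF this assms[of "x + c"]] show ?thesis by (simp add: o_def)
  qed
  thus ?thesis unfolding finite_diff_def[abs_def]
    by (intro has_vector_derivative_sum has_vector_derivative_mult_right)
qed

text \<open>A mean value inequality for differences of order \<open>n + 1\<close>, by induction on the order. The
  last step, from \<open>u n\<close> to its increments, is left to the caller: there \<open>u n\<close> is an absolutely
  continuous function and the increments are integrals.\<close>

lemma norm_finite_diff_le_derivative:
  fixes u :: "nat \<Rightarrow> real \<Rightarrow> complex"
  assumes "h \<ge> 0" "B \<ge> 0"
    and "\<And>j x. j < n \<Longrightarrow> (u j has_vector_derivative u (Suc j) x) (at x)"
    and "\<And>z. x \<le> z \<Longrightarrow> z \<le> x + real n * h \<Longrightarrow> norm (u n z - u n (z + h)) \<le> B"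
  shows "norm (finite_diff (Suc n) h (u 0) x) \<le> h ^ n * B"
  using assms(3,4)
proof (induction n arbitrary: u x)
  case 0
  thus ?case by (simp add: finite_diff_Suc)
next
  case (Suc n)
  define v where "v = finite_diff (Suc n) h (u 0)"
  define v' where "v' = finite_diff (Suc n) h (u (Suc 0))"
  have der: "(v has_vector_derivative v' y) (at y)" for y
    unfolding v_def v'_def using Suc.prems(1)[of 0] by (intro has_vector_derivative_finite_diff) auto
  have bound: "norm (v' y) \<le> h ^ n * B" if y: "x \<le> y" "y \<le> x + h" for y
    unfolding v'_def
  proof (rule Suc.IH[of "\<lambda>j. u (Suc j)" y])
    show "(u (Suc j) has_vector_derivative u (Suc (Suc j)) z) (at z)" if "j < n" for j z
      using that by (intro Suc.prems(1)) auto
    show "norm (u (Suc n) z - u (Suc n) (z + h)) \<le> B" if "y \<le> z" "z \<le> y + real n * h" for z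
      using that y by (intro Suc.prems(2)) (auto simp: algebra_simps)
  qed
  have "norm (v x - v (x + h)) \<le> (h ^ n * B) * norm (x - (x + h))"
  proof (rule differentiable_bound[where S = "{x..x + h}" and f' = "\<lambda>y t. t *\<^sub>R v' y"])
    show "(v has_derivative (\<lambda>t. t *\<^sub>R v' y)) (at y within {x..x + h})" for y
      using der[of y] unfolding has_vector_derivative_def by (rule has_derivative_at_withinI)
    show "onorm (\<lambda>t. t *\<^sub>R v' y) \<le> h ^ n * B" if "y \<in> {x..x + h}" for y
      using bound[of y] that by (subst onorm_scaleR_left) (auto simp: onorm_id bounded_linear_ident)
  qed (use assms in auto)
  also have "\<dots> = h ^ Suc n * B" using assms(1) by simp
  finally show ?case using finite_diff_Suc[of "Suc n" h "u 0" x] by (simp add: v_def)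
qed

section \<open>A pointwise bound by differences with small steps\<close>

text \<open>Either \<open>D\<close> is at least half of \<open>\<mu>\<close>, or \<open>S\<close> is. The point is that \<open>S\<close> enters linearly on the right,
  so that an \<open>L\<^sup>1\<close> bound for it can be used although \<open>p < 1\<close>.\<close>

lemma powr_le_of_le_add:
  fixes \<mu> D S p :: real
  assumes "0 < \<mu>" "0 \<le> D" "0 \<le> S" "\<mu> \<le> D + S" "0 < p" "p < 1"
  shows "\<mu> powr p \<le> 2 * D powr p + 2 * \<mu> powr (p - 1) * S"
proof (cases "S \<le> \<mu> / 2")
  case True
  hence "\<mu> \<le> 2 * D" using assms by simp
  hence "\<mu> powr p \<le> (2 * D) powr p" using assms by (intro powr_mono2) auto
  also have "\<dots> = 2 powr p * D powr p" using assms by (simp add: powr_mult)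
  also have "2 powr p \<le> 2 powr (1::real)" using assms by (intro powr_mono) auto
  hence "2 powr p * D powr p \<le> 2 * D powr p" by (intro mult_right_mono) auto
  finally show ?thesis using assms by (simp add: add_increasing2)
next
  case False
  have "\<mu> powr p = \<mu> powr (p - 1) * \<mu>" using assms by (simp add: powr_diff)
  also have "\<dots> \<le> \<mu> powr (p - 1) * (2 * S)" using False by (intro mult_left_mono) auto
  finally show ?thesis using assms by (simp add: add_increasing)
qed

lemma nn_integral_dilate_le:
  fixes F :: "real \<Rightarrow> ennreal"
  assumes [measurable]: "F \<in> borel_measurable borel" and \<nu>: "\<nu> \<ge> 1" and sub: "{y<..<y + \<nu> * \<tau>} \<subseteq> J"
  shows "(\<integral>\<^sup>+t\<in>{0<..<\<tau>}. F (y + \<nu> * t) \<partial>lborel) \<le> (\<integral>\<^sup>+t\<in>J. F t \<partial>lborel)"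
proof -
  let ?F = "\<lambda>t. F t * indicator {y<..<y + \<nu> * \<tau>} t"
  have "(\<integral>\<^sup>+t\<in>{0<..<\<tau>}. F (y + \<nu> * t) \<partial>lborel) = (\<integral>\<^sup>+t. ?F (y + \<nu> * t) \<partial>lborel)"
    using \<nu> by (intro nn_integral_cong) (auto simp: indicator_def zero_less_mult_iff)
  also have "\<dots> \<le> ennreal \<bar>\<nu>\<bar> * (\<integral>\<^sup>+t. ?F (y + \<nu> * t) \<partial>lborel)"
    using mult_right_mono[of 1 "ennreal \<bar>\<nu>\<bar>" "\<integral>\<^sup>+t. ?F (y + \<nu> * t) \<partial>lborel"] \<nu> by simp
  also have "\<dots> = (\<integral>\<^sup>+t. ?F t \<partial>lborel)"
    using \<nu> by (intro nn_integral_real_affine[symmetric]) auto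
  also have "\<dots> \<le> (\<integral>\<^sup>+t\<in>J. F t \<partial>lborel)"
    using sub by (intro nn_integral_mono) (auto simp: indicator_def)
  finally show ?thesis .
qed

text \<open>Integrated over \<open>y\<close>, this is the \<open>p\<close>-th power of a seminorm of the Besov space with smoothness
  \<open>1/p - 1\<close> and both exponents \<open>p\<close>, restricted to steps below \<open>h\<close>.\<close>

definition diff_energy :: "real \<Rightarrow> nat \<Rightarrow> real \<Rightarrow> (real \<Rightarrow> complex) \<Rightarrow> real \<Rightarrow> ennreal" where
  "diff_energy p m h G y = (\<integral>\<^sup>+t\<in>{0<..<h}. ennreal (t powr (p - 2) * norm (finite_diff m t G y) powr p) \<partial>lborel)"

text \<open>The heart of the proof. Let \<open>\<mu> = |G y|\<close>. A translate \<open>|G (y + \<nu> t)|\<close> is on average over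
  \<open>0 < t < \<tau>\<close> at most \<open>N / \<tau>\<close>, which is small against \<open>\<mu>\<close> if \<open>\<tau>\<close> is a large multiple of \<open>N / \<mu>\<close>. Then
  the difference \<open>\<Delta>\<^sub>t\<^sup>m G (y)\<close> is on average comparable to \<open>\<mu>\<close>,
  which makes \<open>diff_energy\<close> at least a constant times \<open>\<tau>\<^sup>p\<^sup>-\<^sup>1 \<mu>\<^sup>p\<close>, that is, \<open>N\<^sup>p\<^sup>-\<^sup>1 \<mu>\<close>. If
  the range does not fit into the interval, then \<open>\<mu>\<close> is at most a multiple of \<open>N / h\<close>, and
  \<open>\<mu> = \<mu>\<^sup>1\<^sup>-\<^sup>p \<mu>\<^sup>p\<close> is bounded by the other term.\<close>

lemma norm_le_local_energy:
  fixes G :: "real \<Rightarrow> complex"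
  assumes [measurable]: "G \<in> borel_measurable borel"
    and p: "0 < p" "p < 1" and m: "m \<ge> 1" and h: "h > 0" and N: "N > 0"
    and int: "(\<integral>\<^sup>+t\<in>{x<..x + 2 * h}. ennreal (norm (G t)) \<partial>lborel) \<le> ennreal N"
    and y: "x \<le> y" "y \<le> x + h"
  shows "ennreal (norm (G y)) \<le> ennreal (4 * (real m * 2 ^ (m + 2)) * N powr (1 - p)) *
     (ennreal (h powr (p - 1) * norm (G y) powr p) + diff_energy p m h G y)"
proof (cases "G y = 0")
  case False
  define \<mu> where "\<mu> = norm (G y)"
  define C where "C = (2::real) ^ (m + 2)"
  define Q where "Q = diff_energy p m h G y"
  have \<mu>: "\<mu> > 0" using False by (simp add: \<mu>_def)
  have C1: "C \<ge> 1" unfolding C_def by (rule one_le_power) simp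
  have mC1: "real m * C \<ge> 1" using m C1 mult_mono[of 1 "real m" 1 C] by simp
  have K0: "4 * (real m * C) * N powr (1 - p) > 0" using mC1 N by simp
  have Npow: "(a * N) powr (1 - p) \<le> a * N powr (1 - p)" if "a \<ge> 1" for a
  proof -
    have "(a * N) powr (1 - p) = a powr (1 - p) * N powr (1 - p)" using that N by (simp add: powr_mult)
    also have "a powr (1 - p) \<le> a powr 1" using that p by (intro powr_mono) auto
    hence "a powr (1 - p) * N powr (1 - p) \<le> a * N powr (1 - p)" using that by (intro mult_right_mono) auto
    finally show ?thesis .
  qed
  \<comment> \<open>Small values of \<open>|G y|\<close> are absorbed by the term with \<open>|G y|\<^sup>p\<close>; for large ones a range of
    steps \<open>t\<close> is available for the differences.\<close>
  show ?thesis
  proof (cases "\<mu> < real m * C * N / h")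
    case True
    have "\<mu> = \<mu> powr (1 - p) * \<mu> powr p" using \<mu> by (simp flip: powr_add)
    also have "\<dots> \<le> (real m * C * N / h) powr (1 - p) * \<mu> powr p"
      using True \<mu> p by (intro mult_right_mono powr_mono2) auto
    also have "(real m * C * N / h) powr (1 - p) = (real m * C * N) powr (1 - p) * h powr (p - 1)"
      using mC1 N h by (simp add: powr_divide powr_minus_divide[of h "1 - p", simplified] )
    also have "(real m * C * N) powr (1 - p) * h powr (p - 1) * \<mu> powr p \<le> (real m * C) * N powr (1 - p) * h powr (p - 1) * \<mu> powr p"
      using Npow[OF mC1] by (intro mult_right_mono) auto
    also have "\<dots> \<le> 4 * ((real m * C) * N powr (1 - p) * h powr (p - 1) * \<mu> powr p)"
      using mult_right_mono[of 1 4 "(real m * C) * N powr (1 - p) * h powr (p - 1) * \<mu> powr p"] mC1 by auto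
    finally have "\<mu> \<le> 4 * (real m * C) * N powr (1 - p) * (h powr (p - 1) * \<mu> powr p)" by (simp add: mult_ac)
    hence "ennreal \<mu> \<le> ennreal (4 * (real m * C) * N powr (1 - p)) * ennreal (h powr (p - 1) * \<mu> powr p)"
      using K0 by (subst ennreal_mult[symmetric]) (auto intro!: ennreal_leI)
    also have "\<dots> \<le> ennreal (4 * (real m * C) * N powr (1 - p)) * (ennreal (h powr (p - 1) * \<mu> powr p) + Q)"
      by (intro mult_left_mono) auto
    finally show ?thesis by (simp add: \<mu>_def C_def Q_def)
  next
    case False
    \<comment> \<open>The range of steps: large enough that the translates \<open>G (y + \<nu> t)\<close>, whose \<open>L\<^sup>1\<close> norm is at
      most \<open>N\<close>, are on average over \<open>(0, \<tau>)\<close> negligible against \<open>\<mu> = |G y|\<close>, and small enough that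
      all of them stay in the interval.\<close>
    define \<tau> where "\<tau> = C * N / \<mu>"
    have \<tau>: "\<tau> > 0" using C1 N \<mu> by (simp add: \<tau>_def)
    have m\<tau>: "real m * \<tau> \<le> h" using False \<mu> h by (simp add: \<tau>_def field_simps)
    have "\<tau> \<le> h" using order_trans[OF mult_right_mono[of 1 "real m" \<tau>] m\<tau>] m \<tau> by simp
    show ?thesis
    proof (cases "Q = \<infinity>")
      case True
      thus ?thesis using K0 m N by (simp add: Q_def C_def ennreal_mult_eq_top_iff ennreal_mult_top)
    next
      case False
      then obtain q where q: "Q = ennreal q" "q \<ge> 0" by (cases Q) auto
      let ?D = "\<lambda>t. norm (finite_diff m t G y) powr p"
      let ?S = "\<lambda>t. \<Sum>\<nu>=1..m. real (m choose \<nu>) * norm (G (y + real \<nu> * t))"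
      have S0: "?S t \<ge> 0" for t by (intro sum_nonneg) auto
      have S_int: "(\<integral>\<^sup>+t\<in>{0<..<\<tau>}. ennreal (?S t) \<partial>lborel) \<le> ennreal (2 ^ m * N)"
      proof -
        have "(\<integral>\<^sup>+t\<in>{0<..<\<tau>}. ennreal (?S t) \<partial>lborel) =
           (\<integral>\<^sup>+t. (\<Sum>\<nu>=1..m. ennreal (real (m choose \<nu>)) * (ennreal (norm (G (y + real \<nu> * t))) * indicator {0<..<\<tau>} t)) \<partial>lborel)"
          by (intro nn_integral_cong) (auto simp: indicator_def ennreal_mult[symmetric] sum_ennreal)
        also have "\<dots> = (\<Sum>\<nu>=1..m. ennreal (real (m choose \<nu>)) * (\<integral>\<^sup>+t\<in>{0<..<\<tau>}. ennreal (norm (G (y + real \<nu> * t))) \<partial>lborel))"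
          by (subst nn_integral_sum) (auto intro!: sum.cong nn_integral_cmult)
        also have "\<dots> \<le> (\<Sum>\<nu>=1..m. ennreal (real (m choose \<nu>)) * ennreal N)"
        proof (intro sum_mono mult_left_mono order_trans[OF _ int])
          fix \<nu> assume \<nu>: "\<nu> \<in> {1..m}"
          have "real \<nu> * \<tau> \<le> h"
            using \<nu> \<tau> order_trans[OF mult_right_mono[of "real \<nu>" "real m" \<tau>] m\<tau>] by auto
          thus "(\<integral>\<^sup>+t\<in>{0<..<\<tau>}. ennreal (norm (G (y + real \<nu> * t))) \<partial>lborel) \<le> (\<integral>\<^sup>+t\<in>{x<..x + 2 * h}. ennreal (norm (G t)) \<partial>lborel)"
            using y \<nu> by (intro nn_integral_dilate_le) auto
        qed auto
        also have "\<dots> = ennreal ((\<Sum>\<nu>=1..m. real (m choose \<nu>)) * N)"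
          using N by (simp add: sum_distrib_right ennreal_mult[symmetric] sum_ennreal flip: sum_distrib_right)
        also have "\<dots> \<le> ennreal (2 ^ m * N)"
        proof (intro ennreal_leI mult_right_mono)
          have "(\<Sum>\<nu>=1..m. real (m choose \<nu>)) \<le> (\<Sum>\<nu>\<le>m. real (m choose \<nu>))"
            by (intro sum_mono2) auto
          also have "\<dots> = 2 ^ m" using choose_row_sum[of m] by (metis of_nat_sum of_nat_power of_nat_numeral)
          finally show "(\<Sum>\<nu>=1..m. real (m choose \<nu>)) \<le> 2 ^ m" .
        qed (use N in auto)
        finally show ?thesis .
      qed
      have D_int: "(\<integral>\<^sup>+t\<in>{0<..<\<tau>}. ennreal (?D t) \<partial>lborel) \<le> ennreal (\<tau> powr (2 - p) * q)"
      proof -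
        have "(\<integral>\<^sup>+t\<in>{0<..<\<tau>}. ennreal (?D t) \<partial>lborel) \<le>
           (\<integral>\<^sup>+t. ennreal (\<tau> powr (2 - p)) * (ennreal (t powr (p - 2) * ?D t) * indicator {0<..<h} t) \<partial>lborel)"
        proof (rule nn_integral_mono)
          fix t
          show "ennreal (?D t) * indicator {0<..<\<tau>} t \<le> ennreal (\<tau> powr (2 - p)) * (ennreal (t powr (p - 2) * ?D t) * indicator {0<..<h} t)"
          proof (cases "0 < t \<and> t < \<tau>")
            case True
            have "1 = t powr (2 - p) * t powr (p - 2)" using True by (simp flip: powr_add)
            also have "\<dots> \<le> \<tau> powr (2 - p) * t powr (p - 2)" using True p by (intro mult_right_mono powr_mono2) auto
            finally have "1 * ?D t \<le> \<tau> powr (2 - p) * t powr (p - 2) * ?D t" by (intro mult_right_mono) auto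
            thus ?thesis using True \<open>\<tau> \<le> h\<close> by (auto simp: indicator_def ennreal_mult[symmetric] mult.assoc intro!: ennreal_leI)
          qed auto
        qed
        also have "\<dots> = ennreal (\<tau> powr (2 - p)) * Q"
          unfolding Q_def diff_energy_def by (intro nn_integral_cmult) measurable
        finally show ?thesis using q by (simp add: ennreal_mult)
      qed
      have "ennreal (\<tau> * \<mu> powr p) = (\<integral>\<^sup>+t\<in>{0<..<\<tau>}. ennreal (\<mu> powr p) \<partial>lborel)"
        using \<tau> by (simp add: nn_integral_cmult_indicator ennreal_mult mult.commute)
      also have "\<dots> \<le> (\<integral>\<^sup>+t. 2 * (ennreal (?D t) * indicator {0<..<\<tau>} t) + ennreal (2 * \<mu> powr (p - 1)) * (ennreal (?S t) * indicator {0<..<\<tau>} t) \<partial>lborel)"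
      proof (rule nn_integral_mono)
        fix t
        have "\<mu> powr p \<le> 2 * ?D t + 2 * \<mu> powr (p - 1) * ?S t"
          using norm_le_finite_diff_plus_translates[of G y m t] \<mu> p S0
          by (intro powr_le_of_le_add) (auto simp: \<mu>_def)
        hence "ennreal (\<mu> powr p) \<le> ennreal (2 * ?D t + 2 * \<mu> powr (p - 1) * ?S t)" by (rule ennreal_leI)
        also have "\<dots> = 2 * ennreal (?D t) + ennreal (2 * \<mu> powr (p - 1)) * ennreal (?S t)"
          using S0 by (simp add: ennreal_plus ennreal_mult)
        finally show "ennreal (\<mu> powr p) * indicator {0<..<\<tau>} t \<le> 2 * (ennreal (?D t) * indicator {0<..<\<tau>} t) + ennreal (2 * \<mu> powr (p - 1)) * (ennreal (?S t) * indicator {0<..<\<tau>} t)"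
          by (auto simp: indicator_def)
      qed
      also have "\<dots> = 2 * (\<integral>\<^sup>+t\<in>{0<..<\<tau>}. ennreal (?D t) \<partial>lborel) + ennreal (2 * \<mu> powr (p - 1)) * (\<integral>\<^sup>+t\<in>{0<..<\<tau>}. ennreal (?S t) \<partial>lborel)"
        by (subst nn_integral_add) (auto simp: nn_integral_cmult)
      also have "\<dots> \<le> 2 * ennreal (\<tau> powr (2 - p) * q) + ennreal (2 * \<mu> powr (p - 1)) * ennreal (2 ^ m * N)"
        by (intro add_mono mult_left_mono D_int S_int) auto
      also have "\<dots> = ennreal (2 * (\<tau> powr (2 - p) * q) + 2 * \<mu> powr (p - 1) * (2 ^ m * N))"
        using q N by (simp add: ennreal_plus ennreal_mult)
      finally have 1: "\<tau> * \<mu> powr p \<le> 2 * (\<tau> powr (2 - p) * q) + 2 * \<mu> powr (p - 1) * (2 ^ m * N)"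
        using q N by (subst (asm) ennreal_le_iff) auto
      \<comment> \<open>This is what the factor \<open>2 ^ (m + 2)\<close> in \<open>\<tau>\<close> is for: the translates take away half of the left-hand side.\<close>
      have "2 * \<mu> powr (p - 1) * (2 ^ m * N) = \<tau> * \<mu> powr p / 2"
        using \<mu> by (simp add: \<tau>_def C_def powr_diff power_add)
      with 1 have "\<tau> * \<mu> powr p \<le> 4 * (\<tau> powr (2 - p) * q)" by simp
      hence "\<tau> powr (p - 1) * \<mu> powr p \<le> 4 * q"
        using \<tau> by (simp add: powr_diff power2_eq_square field_simps)
      moreover have "\<tau> powr (p - 1) * \<mu> powr p = (C * N) powr (p - 1) * \<mu>"
        using \<mu> C1 N by (simp add: \<tau>_def powr_divide powr_diff)
      ultimately have "(C * N) powr (p - 1) * \<mu> \<le> 4 * q" by simp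
      hence "(C * N) powr (1 - p) * ((C * N) powr (p - 1) * \<mu>) \<le> (C * N) powr (1 - p) * (4 * q)"
        by (intro mult_left_mono) auto
      moreover have "(C * N) powr (1 - p) * (C * N) powr (p - 1) = 1"
        using C1 N by (simp flip: powr_add)
      ultimately have "\<mu> \<le> (C * N) powr (1 - p) * (4 * q)" by (simp flip: mult.assoc)
      also have "\<dots> \<le> C * N powr (1 - p) * (4 * q)" using Npow[OF C1] q by (intro mult_right_mono) auto
      also have "\<dots> \<le> (real m * C) * N powr (1 - p) * (4 * q)"
        using C1 m q mult_right_mono[of 1 "real m" C] by (intro mult_right_mono) auto
      finally have "\<mu> \<le> 4 * (real m * C) * N powr (1 - p) * q" by (simp add: mult_ac)
      hence "ennreal \<mu> \<le> ennreal (4 * (real m * C) * N powr (1 - p)) * ennreal q"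
        using K0 q by (subst ennreal_mult[symmetric]) (auto intro!: ennreal_leI)
      also have "\<dots> \<le> ennreal (4 * (real m * C) * N powr (1 - p)) * (ennreal (h powr (p - 1) * \<mu> powr p) + Q)"
        unfolding q(1) by (intro mult_left_mono) auto
      finally show ?thesis by (simp add: \<mu>_def C_def Q_def)
    qed
  qed
qed simp

section \<open>Local integrals and differences on the circle\<close>

text \<open>If \<open>n2\<close> is not much larger than \<open>n1\<close>, the hypothesis can be divided by \<open>n1\<^sup>1\<^sup>-\<^sup>p\<close>; otherwise
  \<open>n1\<close> is dominated by a small multiple of \<open>n2\<close>. The factor \<open>1/4\<close> is small enough for the absorption in
  which the lemma is used.\<close>

lemma powr_le_of_self_improving:
  fixes n1 n2 K p :: real
  assumes p: "0 < p" "p < 1" and n: "0 \<le> n1" "0 \<le> n2" and K: "K > 0"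
    and le: "ennreal n1 \<le> ennreal (K * n2 powr (1 - p)) * B"
  shows "ennreal (n1 powr p) \<le> ennreal (n2 powr p / 4) + ennreal (K * 4 powr ((1 - p) / p)) * B"
proof (cases "n1 powr p \<le> n2 powr p / 4 \<or> B = \<infinity>")
  case True
  thus ?thesis
  proof
    assume "n1 powr p \<le> n2 powr p / 4"
    hence "ennreal (n1 powr p) \<le> ennreal (n2 powr p / 4)" by (rule ennreal_leI)
    thus ?thesis by (rule order_trans) simp
  next
    assume "B = \<infinity>"
    thus ?thesis using K by (simp add: ennreal_mult_top)
  qed
next
  case False
  then obtain b where b: "B = ennreal b" "b \<ge> 0" by (cases B) auto
  have lt: "n2 powr p < 4 * n1 powr p" using False by simp
  hence n1: "n1 > 0" using n p by (cases "n1 = 0") (auto simp: not_less)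
  have "n2 powr (1 - p) = (n2 powr p) powr ((1 - p) / p)" using p by (simp add: powr_powr)
  also have "\<dots> \<le> (4 * n1 powr p) powr ((1 - p) / p)"
    using lt p by (intro powr_mono2) auto
  also have "\<dots> = 4 powr ((1 - p) / p) * n1 powr (1 - p)"
    using p by (simp add: powr_mult powr_powr)
  finally have *: "n2 powr (1 - p) \<le> 4 powr ((1 - p) / p) * n1 powr (1 - p)" .
  have "n1 \<le> K * n2 powr (1 - p) * b"
    using le b K by (simp add: ennreal_mult[symmetric] ennreal_le_iff)
  also have "\<dots> \<le> K * (4 powr ((1 - p) / p) * n1 powr (1 - p)) * b"
    using * K b by (intro mult_right_mono mult_left_mono) auto
  finally have "n1 * n1 powr (p - 1) \<le> K * (4 powr ((1 - p) / p) * n1 powr (1 - p)) * b * n1 powr (p - 1)"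
    by (intro mult_right_mono) auto
  also have "n1 * n1 powr (p - 1) = n1 powr p" using n1 by (simp add: powr_diff)
  also have "K * (4 powr ((1 - p) / p) * n1 powr (1 - p)) * b * n1 powr (p - 1) = K * 4 powr ((1 - p) / p) * b * (n1 powr (1 - p) * n1 powr (p - 1))"
    by (simp add: mult_ac)
  also have "n1 powr (1 - p) * n1 powr (p - 1) = 1" using n1 by (simp flip: powr_add)
  finally have "ennreal (n1 powr p) \<le> ennreal (K * 4 powr ((1 - p) / p)) * B"
    using b K by (simp add: ennreal_mult[symmetric] ennreal_leI)
  thus ?thesis by (rule order_trans) simp
qed

lemma powr_add_le:
  fixes a b p :: real
  assumes "0 \<le> a" "0 \<le> b" "0 < p" "p \<le> 1"
  shows "(a + b) powr p \<le> a powr p + b powr p"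
proof (cases "a + b = 0")
  case False
  hence pos: "a + b > 0" using assms by simp
  have *: "c / (a + b) \<le> (c / (a + b)) powr p" if "0 \<le> c" "c \<le> a + b" for c
  proof (cases "c = 0")
    case False
    hence "c / (a + b) = (c / (a + b)) powr 1" using that pos by simp
    also have "\<dots> \<le> (c / (a + b)) powr p"
      using that pos False assms by (intro powr_mono') auto
    finally show ?thesis .
  qed simp
  have "1 = a / (a + b) + b / (a + b)" using pos by (simp add: add_divide_distrib[symmetric])
  also have "\<dots> \<le> (a / (a + b)) powr p + (b / (a + b)) powr p"
    using *[of a] *[of b] assms by simp
  also have "\<dots> = (a powr p + b powr p) / (a + b) powr p"
    using assms pos by (simp add: powr_divide add_divide_distrib)
  finally show ?thesis using pos by (simp add: field_simps)
qed (use assms in auto)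

lemma powr_sum_le:
  fixes f :: "'a \<Rightarrow> real"
  assumes "finite A" "\<And>i. i \<in> A \<Longrightarrow> 0 \<le> f i" "0 < p" "p \<le> 1"
  shows "(\<Sum>i\<in>A. f i) powr p \<le> (\<Sum>i\<in>A. f i powr p)"
  using assms
proof (induction A rule: finite_induct)
  case (insert x A)
  have "(f x + sum f A) powr p \<le> f x powr p + sum f A powr p"
    using insert by (intro powr_add_le sum_nonneg) auto
  thus ?case using insert by (auto intro: order_trans)
qed simp

lemma nn_integral_period_shift:
  fixes F :: "real \<Rightarrow> ennreal"
  assumes [measurable]: "F \<in> borel_measurable borel" and per: "periodic_2pi F"
  shows "(\<integral>\<^sup>+x\<in>{0..<2 * pi}. F (x + c) \<partial>lborel) = (\<integral>\<^sup>+x\<in>{0..<2 * pi}. F x \<partial>lborel)"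
proof -
  have shift: "(\<integral>\<^sup>+x\<in>{a..<b}. F (x + d) \<partial>lborel) = (\<integral>\<^sup>+x\<in>{a + d..<b + d}. F x \<partial>lborel)" for a b d
    by (subst nn_integral_real_affine[where c = 1 and t = d and f = "\<lambda>x. F x * indicator {a + d..<b + d} x"])
       (auto intro!: nn_integral_cong simp: indicator_def add.commute)
  have split: "(\<integral>\<^sup>+x\<in>{a..<c}. F x \<partial>lborel) = (\<integral>\<^sup>+x\<in>{a..<b}. F x \<partial>lborel) + (\<integral>\<^sup>+x\<in>{b..<c}. F x \<partial>lborel)"
    if "a \<le> b" "b \<le> c" for a b c
    using that by (subst nn_integral_add[symmetric]) (auto intro!: nn_integral_cong simp: indicator_def)
  define j where "j = \<lfloor>c / (2 * pi)\<rfloor>"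
  define d where "d = c - 2 * pi * of_int j"
  have "of_int j \<le> c / (2 * pi)" "c / (2 * pi) < of_int j + 1" by (simp_all add: j_def)
  hence d: "0 \<le> d" "d \<le> 2 * pi" by (simp_all add: d_def field_simps)
  have "F (x + c) = F (x + d)" for x
    using periodic_2pi_int[OF per, of "x + d" j] by (simp add: d_def)
  hence "(\<integral>\<^sup>+x\<in>{0..<2 * pi}. F (x + c) \<partial>lborel) = (\<integral>\<^sup>+x\<in>{0..<2 * pi}. F (x + d) \<partial>lborel)" by simp
  also have "\<dots> = (\<integral>\<^sup>+x\<in>{d..<2 * pi + d}. F x \<partial>lborel)" unfolding shift by simp
  also have "\<dots> = (\<integral>\<^sup>+x\<in>{d..<2 * pi}. F x \<partial>lborel) + (\<integral>\<^sup>+x\<in>{2 * pi..<2 * pi + d}. F x \<partial>lborel)"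
    using d by (intro split) auto
  also have "(\<integral>\<^sup>+x\<in>{2 * pi..<2 * pi + d}. F x \<partial>lborel) = (\<integral>\<^sup>+x\<in>{0..<d}. F (x + 2 * pi) \<partial>lborel)"
    unfolding shift by (simp add: add.commute)
  also have "\<dots> = (\<integral>\<^sup>+x\<in>{0..<d}. F x \<partial>lborel)" using per by (simp add: periodic_2pi_def)
  also have "(\<integral>\<^sup>+x\<in>{d..<2 * pi}. F x \<partial>lborel) + (\<integral>\<^sup>+x\<in>{0..<d}. F x \<partial>lborel) = (\<integral>\<^sup>+x\<in>{0..<2 * pi}. F x \<partial>lborel)"
    using split[of 0 d "2 * pi"] d by (simp add: add.commute)
  finally show ?thesis .
qed

text \<open>For \<open>p < 1\<close> the triangle inequality holds for this \<open>p\<close>-th power and fails for the norm itself.\<close>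

definition Lp_power :: "real \<Rightarrow> (real \<Rightarrow> complex) \<Rightarrow> ennreal" where
  "Lp_power p f = (\<integral>\<^sup>+x\<in>{0..<2 * pi}. ennreal (norm (f x) powr p) \<partial>lborel)"

lemma Lp_power_finite_diff_le:
  assumes [measurable]: "F \<in> borel_measurable borel" and per: "periodic_2pi F" and p: "0 < p" "p \<le> 1"
  shows "Lp_power p (finite_diff k h F) \<le> 2 ^ k * Lp_power p F"
proof (induction k)
  case (Suc k)
  let ?D = "\<lambda>x. ennreal (norm (finite_diff k h F x) powr p)"
  have "Lp_power p (finite_diff (Suc k) h F) \<le> (\<integral>\<^sup>+x. ?D x * indicator {0..<2 * pi} x + ?D (x + h) * indicator {0..<2 * pi} x \<partial>lborel)"
    unfolding Lp_power_def
  proof (rule nn_integral_mono)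
    fix x
    have "norm (finite_diff (Suc k) h F x) powr p \<le> (norm (finite_diff k h F x) + norm (finite_diff k h F (x + h))) powr p"
      unfolding finite_diff_Suc using p by (intro powr_mono2 norm_triangle_ineq4) auto
    also have "\<dots> \<le> norm (finite_diff k h F x) powr p + norm (finite_diff k h F (x + h)) powr p"
      using p by (intro powr_add_le) auto
    finally have "ennreal (norm (finite_diff (Suc k) h F x) powr p) \<le>
        ennreal (norm (finite_diff k h F x) powr p + norm (finite_diff k h F (x + h)) powr p)"
      by (rule ennreal_leI)
    hence "ennreal (norm (finite_diff (Suc k) h F x) powr p) \<le> ?D x + ?D (x + h)" by simp
    thus "ennreal (norm (finite_diff (Suc k) h F x) powr p) * indicator {0..<2 * pi} x \<le> ?D x * indicator {0..<2 * pi} x + ?D (x + h) * indicator {0..<2 * pi} x"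
      by (auto simp: indicator_def)
  qed
  also have "\<dots> = (\<integral>\<^sup>+x\<in>{0..<2 * pi}. ?D x \<partial>lborel) + (\<integral>\<^sup>+x\<in>{0..<2 * pi}. ?D (x + h) \<partial>lborel)"
    by (intro nn_integral_add) measurable
  also have "(\<integral>\<^sup>+x\<in>{0..<2 * pi}. ?D (x + h) \<partial>lborel) = (\<integral>\<^sup>+x\<in>{0..<2 * pi}. ?D x \<partial>lborel)"
  proof (rule nn_integral_period_shift[where F = ?D])
    show "periodic_2pi ?D"
      using spec[OF finite_diff_periodic[OF per, of k h, unfolded periodic_2pi_def]] by (simp add: periodic_2pi_def)
  qed measurable
  also have "(\<integral>\<^sup>+x\<in>{0..<2 * pi}. ?D x \<partial>lborel) + (\<integral>\<^sup>+x\<in>{0..<2 * pi}. ?D x \<partial>lborel) = 2 * Lp_power p (finite_diff k h F)"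
    unfolding Lp_power_def by (rule mult_2[symmetric])
  also have "\<dots> \<le> 2 * (2 ^ k * Lp_power p F)" by (intro mult_left_mono Suc.IH) auto
  finally show ?case by (simp add: mult.assoc)
qed simp

text \<open>The \<open>L\<^sup>1\<close> norm on \<open>(x, x + h]\<close>, written with a fixed domain of integration for the sake of
  measurability in \<open>x\<close>.\<close>

definition local_L1 :: "(real \<Rightarrow> complex) \<Rightarrow> real \<Rightarrow> real \<Rightarrow> ennreal" where
  "local_L1 G h x = (\<integral>\<^sup>+s\<in>{0<..h}. ennreal (norm (G (x + s))) \<partial>lborel)"

lemma borel_measurable_local_L1[measurable]:
  assumes [measurable]: "G \<in> borel_measurable borel"
  shows "local_L1 G h \<in> borel_measurable borel"
  unfolding local_L1_def by measurable

lemma local_L1_eq: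
  assumes [measurable]: "G \<in> borel_measurable borel"
  shows "local_L1 G h x = (\<integral>\<^sup>+t\<in>{x<..x + h}. ennreal (norm (G t)) \<partial>lborel)"
  unfolding local_L1_def
  by (subst nn_integral_real_affine[where c = 1 and t = x and f = "\<lambda>t. ennreal (norm (G t)) * indicator {x<..x + h} t"])
     (auto intro!: nn_integral_cong simp: indicator_def)

lemma local_L1_add:
  assumes [measurable]: "G \<in> borel_measurable borel" and "h \<ge> 0" "h' \<ge> 0"
  shows "local_L1 G (h + h') x = local_L1 G h x + local_L1 G h' (x + h)"
  unfolding local_L1_eq[OF assms(1)]
  using assms by (subst nn_integral_add[symmetric]) (auto intro!: nn_integral_cong simp: indicator_def)

lemma local_L1_multiple:
  assumes G: "G \<in> borel_measurable borel" and h: "h \<ge> 0"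
  shows "local_L1 G (real r * h) x = (\<Sum>i<r. local_L1 G h (x + real i * h))"
proof (induction r)
  case 0
  show ?case by (simp add: local_L1_def)
next
  case (Suc r)
  have "local_L1 G (real (Suc r) * h) x = local_L1 G (real r * h + h) x" by (simp add: algebra_simps)
  also have "\<dots> = local_L1 G (real r * h) x + local_L1 G h (x + real r * h)"
    using h by (intro local_L1_add[OF G]) auto
  finally show ?case by (simp add: Suc.IH)
qed

lemma local_L1_finite:
  assumes "\<And>a b. (\<integral>\<^sup>+t\<in>{a<..b}. ennreal (norm (G t)) \<partial>lborel) < \<infinity>" "G \<in> borel_measurable borel"
  shows "local_L1 G h x < \<infinity>"
  using assms local_L1_eq by simp

lemma primitive_locally_finite:
  assumes pr: "primitive w g"
  shows "(\<integral>\<^sup>+t\<in>{a<..b}. ennreal (norm (g t)) \<partial>lborel) < \<infinity>"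
proof (cases "a \<le> b")
  case True
  hence "integrable lborel (\<lambda>t. indicator {a<..b} t *\<^sub>R g t)"
    using pr by (auto simp: primitive_def set_integrable_def)
  hence "(\<integral>\<^sup>+t. ennreal (norm (indicator {a<..b} t *\<^sub>R g t)) \<partial>lborel) < \<infinity>"
    unfolding integrable_iff_bounded by simp
  also have "(\<integral>\<^sup>+t. ennreal (norm (indicator {a<..b} t *\<^sub>R g t)) \<partial>lborel) = (\<integral>\<^sup>+t\<in>{a<..b}. ennreal (norm (g t)) \<partial>lborel)"
    by (intro nn_integral_cong) (auto simp: indicator_def)
  finally show ?thesis .
qed simp

lemma primitive_norm_le:
  assumes pr: "primitive w g" and h: "h \<ge> 0" and sub: "{z<..z + h} \<subseteq> {x<..x + L}" and L: "L \<ge> 0"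
  shows "norm (w z - w (z + h)) \<le> enn2real (local_L1 g L x)"
proof -
  have g[measurable]: "g \<in> borel_measurable borel" using pr by (simp add: primitive_def)
  have iL: "set_integrable lborel {x<..x + L} g" and iz: "set_integrable lborel {z<..z + h} g"
    and eq: "w (z + h) - w z = (\<integral>t\<in>{z<..z + h}. g t \<partial>lborel)"
    using pr h L by (auto simp: primitive_def)
  have nn: "(\<integral>\<^sup>+t\<in>A. ennreal (norm (g t)) \<partial>lborel) = (\<integral>\<^sup>+t. ennreal (norm (indicator A t *\<^sub>R g t)) \<partial>lborel)" for A
    by (intro nn_integral_cong) (auto simp: indicator_def)
  have fin: "local_L1 g L x < \<infinity>"
    using iL unfolding local_L1_eq[OF g] nn set_integrable_def integrable_iff_bounded by simp
  have "ennreal (norm (w (z + h) - w z)) \<le> (\<integral>\<^sup>+t. ennreal (norm (indicator {z<..z + h} t *\<^sub>R g t)) \<partial>lborel)"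
    using iz unfolding eq set_lebesgue_integral_def set_integrable_def by (rule integral_norm_bound_ennreal)
  also have "\<dots> \<le> local_L1 g L x"
    unfolding local_L1_eq[OF g] nn[symmetric]
    using sub by (intro nn_integral_mono) (auto simp: indicator_def)
  finally have "norm (w (z + h) - w z) \<le> enn2real (local_L1 g L x)"
    using fin by (metis enn2real_ennreal enn2real_mono norm_ge_zero infinity_ennreal_def)
  thus ?thesis by (simp add: norm_minus_commute)
qed

definition total_energy :: "real \<Rightarrow> nat \<Rightarrow> real \<Rightarrow> (real \<Rightarrow> complex) \<Rightarrow> real \<Rightarrow> ennreal" where
  "total_energy p m h G y = ennreal (h powr (p - 1) * norm (G y) powr p) + diff_energy p m h G y"

lemma borel_measurable_diff_energy[measurable]:
  assumes [measurable]: "G \<in> borel_measurable borel"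
  shows "diff_energy p m h G \<in> borel_measurable borel"
  unfolding diff_energy_def by measurable

lemma borel_measurable_total_energy[measurable]:
  assumes [measurable]: "G \<in> borel_measurable borel"
  shows "total_energy p m h G \<in> borel_measurable borel"
  unfolding total_energy_def by measurable

text \<open>Integrating the pointwise bound over \<open>(x, x + h]\<close> bounds the \<open>L\<^sup>1\<close> norm on this interval by
  a power of the \<open>L\<^sup>1\<close> norm on the doubled interval, the translates in the differences reaching that far.\<close>

lemma local_L1_powr_le:
  fixes G :: "real \<Rightarrow> complex"
  assumes G[measurable]: "G \<in> borel_measurable borel"
    and fin: "\<And>a b. (\<integral>\<^sup>+t\<in>{a<..b}. ennreal (norm (G t)) \<partial>lborel) < \<infinity>"
    and p: "0 < p" "p < 1" and m: "m \<ge> 1" and h: "h > 0"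
  shows "ennreal (enn2real (local_L1 G h x) powr p) \<le> ennreal (enn2real (local_L1 G (2 * h) x) powr p / 4) +
    ennreal (4 * (real m * 2 ^ (m + 2)) * 4 powr ((1 - p) / p)) * (\<integral>\<^sup>+s\<in>{0<..h}. total_energy p m h G (x + s) \<partial>lborel)"
proof -
  define K where "K = 4 * (real m * 2 ^ (m + 2))"
  have K: "K > 0" using m by (simp add: K_def)
  define n1 where "n1 = enn2real (local_L1 G h x)"
  define n2 where "n2 = enn2real (local_L1 G (2 * h) x)"
  have e1: "local_L1 G h x = ennreal n1" and e2: "local_L1 G (2 * h) x = ennreal n2"
    using local_L1_finite[OF fin G] by (auto simp: n1_def n2_def less_top)
  have n: "0 \<le> n1" "0 \<le> n2" by (auto simp: n1_def n2_def)
  have "local_L1 G h x \<le> local_L1 G (2 * h) x"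
    using local_L1_add[OF G, of h h x] h by simp
  hence n12: "n1 \<le> n2" using e1 e2 n by simp
  have "ennreal n1 \<le> ennreal (K * n2 powr (1 - p)) * (\<integral>\<^sup>+s\<in>{0<..h}. total_energy p m h G (x + s) \<partial>lborel)"
  proof (cases "n2 = 0")
    case True
    thus ?thesis using n n12 by simp
  next
    case False
    hence n2: "n2 > 0" using n by simp
    have "ennreal n1 = (\<integral>\<^sup>+s\<in>{0<..h}. ennreal (norm (G (x + s))) \<partial>lborel)"
      unfolding e1[symmetric] local_L1_def ..
    also have "\<dots> \<le> (\<integral>\<^sup>+s. ennreal (K * n2 powr (1 - p)) * (total_energy p m h G (x + s) * indicator {0<..h} s) \<partial>lborel)"
    proof (rule nn_integral_mono)
      fix s
      show "ennreal (norm (G (x + s))) * indicator {0<..h} s \<le> ennreal (K * n2 powr (1 - p)) * (total_energy p m h G (x + s) * indicator {0<..h} s)"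
      proof (cases "s \<in> {0<..h}")
        case True
        have "ennreal (norm (G (x + s))) \<le> ennreal (K * n2 powr (1 - p)) * total_energy p m h G (x + s)"
          unfolding K_def total_energy_def
          using True e2 local_L1_eq[OF G] by (intro norm_le_local_energy[OF G p m h n2, of x]) auto
        thus ?thesis using True by simp
      qed simp
    qed
    also have "\<dots> = ennreal (K * n2 powr (1 - p)) * (\<integral>\<^sup>+s\<in>{0<..h}. total_energy p m h G (x + s) \<partial>lborel)"
      by (intro nn_integral_cmult) measurable
    finally show ?thesis .
  qed
  from powr_le_of_self_improving[OF p n K this] show ?thesis by (simp add: K_def n1_def n2_def)
qed

text \<open>A local embedding of the Besov space into \<open>L\<^sup>1\<close>, averaged in \<open>L\<^sup>p\<close> over the circle. The doubled
  interval on the right of the preceding bound is absorbed, and Fubini's theorem turns the remaining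
  terms into the \<open>L\<^sup>p\<close> norms of \<open>G\<close> and of its differences.\<close>

theorem local_L1_Lp_le:
  fixes G :: "real \<Rightarrow> complex"
  assumes G[measurable]: "G \<in> borel_measurable borel" and per: "periodic_2pi G"
    and fin: "\<And>a b. (\<integral>\<^sup>+t\<in>{a<..b}. ennreal (norm (G t)) \<partial>lborel) < \<infinity>"
    and p: "0 < p" "p < 1" and m: "m \<ge> 1" and h: "h > 0"
  shows "(\<integral>\<^sup>+x\<in>{0..<2 * pi}. ennreal (enn2real (local_L1 G h x) powr p) \<partial>lborel) \<le>
    ennreal (2 * (4 * (real m * 2 ^ (m + 2)) * 4 powr ((1 - p) / p))) *
     (ennreal (h powr p) * Lp_power p G +
      ennreal h * (\<integral>\<^sup>+t\<in>{0<..<h}. ennreal (t powr (p - 2)) * Lp_power p (finite_diff m t G) \<partial>lborel))"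
proof -
  define K where "K = 4 * (real m * 2 ^ (m + 2)) * 4 powr ((1 - p) / p)"
  have K: "K > 0" using m by (simp add: K_def)
  define n where "n = (\<lambda>x. enn2real (local_L1 G h x))"
  define E where "E = total_energy p m h G"
  have [measurable]: "n \<in> borel_measurable borel" unfolding n_def by measurable
  have [measurable]: "E \<in> borel_measurable borel" unfolding E_def by measurable
  have e1: "local_L1 G h x = ennreal (n x)" for x
    using local_L1_finite[OF fin G] by (auto simp: n_def less_top)
  have n0: "0 \<le> n x" for x by (simp add: n_def)
  have Gp: "G (x + 2 * pi + s) = G (x + s)" for x s
    using spec[OF per[unfolded periodic_2pi_def], of "x + s"] by (simp add: algebra_simps)
  have pern: "periodic_2pi n"
    by (simp add: periodic_2pi_def n_def local_L1_def Gp)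
  have perE: "periodic_2pi E"
    using per finite_diff_periodic[OF per] by (simp add: periodic_2pi_def E_def total_energy_def diff_energy_def)
  let ?A = "\<integral>\<^sup>+x\<in>{0..<2 * pi}. ennreal (n x powr p) \<partial>lborel"
  let ?B = "\<integral>\<^sup>+x\<in>{0..<2 * pi}. (\<integral>\<^sup>+s\<in>{0<..h}. E (x + s) \<partial>lborel) \<partial>lborel"
  \<comment> \<open>The larger norm is the sum of two translates of the smaller one, so it costs only a half of
    the left-hand side after integration over the circle.\<close>
  have pw: "ennreal (n x powr p) \<le> ennreal (1/4) * ennreal (n x powr p) + ennreal (1/4) * ennreal (n (x + h) powr p) +
     ennreal K * (\<integral>\<^sup>+s\<in>{0<..h}. E (x + s) \<partial>lborel)" for x
  proof -
    have "local_L1 G (2 * h) x = ennreal (n x) + ennreal (n (x + h))"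
      using local_L1_add[OF G, of h h x] h by (simp add: e1)
    hence "enn2real (local_L1 G (2 * h) x) = n x + n (x + h)"
      using n0 by (simp add: ennreal_plus[symmetric] del: ennreal_plus)
    hence "enn2real (local_L1 G (2 * h) x) powr p / 4 \<le> (1/4) * n x powr p + (1/4) * n (x + h) powr p"
      using powr_add_le[of "n x" "n (x + h)" p] n0 p by simp
    hence "ennreal (enn2real (local_L1 G (2 * h) x) powr p / 4) \<le> ennreal ((1/4) * n x powr p + (1/4) * n (x + h) powr p)"
      by (rule ennreal_leI)
    also have "\<dots> = ennreal (1/4) * ennreal (n x powr p) + ennreal (1/4) * ennreal (n (x + h) powr p)"
      by (subst ennreal_plus) (auto simp: ennreal_mult[symmetric])
    finally have "ennreal (enn2real (local_L1 G (2 * h) x) powr p / 4) + ennreal K * (\<integral>\<^sup>+s\<in>{0<..h}. E (x + s) \<partial>lborel)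
      \<le> ennreal (1/4) * ennreal (n x powr p) + ennreal (1/4) * ennreal (n (x + h) powr p) + ennreal K * (\<integral>\<^sup>+s\<in>{0<..h}. E (x + s) \<partial>lborel)"
      by (rule add_right_mono)
    moreover have "ennreal (n x powr p) \<le> ennreal (enn2real (local_L1 G (2 * h) x) powr p / 4) + ennreal K * (\<integral>\<^sup>+s\<in>{0<..h}. E (x + s) \<partial>lborel)"
      using local_L1_powr_le[OF G fin p m h, of x] unfolding K_def E_def n_def .
    ultimately show ?thesis by (rule order_trans[rotated])
  qed
  have "?A \<le> (\<integral>\<^sup>+x. ennreal (1/4) * (ennreal (n x powr p) * indicator {0..<2 * pi} x) + ennreal (1/4) * (ennreal (n (x + h) powr p) * indicator {0..<2 * pi} x) +
     ennreal K * ((\<integral>\<^sup>+s\<in>{0<..h}. E (x + s) \<partial>lborel) * indicator {0..<2 * pi} x) \<partial>lborel)"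
    using pw by (intro nn_integral_mono) (auto simp: indicator_def)
  also have "\<dots> = ennreal (1/4) * ?A + ennreal (1/4) * (\<integral>\<^sup>+x\<in>{0..<2 * pi}. ennreal (n (x + h) powr p) \<partial>lborel) + ennreal K * ?B"
    by (simp add: nn_integral_add nn_integral_cmult)
  also have "(\<integral>\<^sup>+x\<in>{0..<2 * pi}. ennreal (n (x + h) powr p) \<partial>lborel) = ?A"
    using pern by (intro nn_integral_period_shift) (auto simp: periodic_2pi_def)
  finally have 1: "?A \<le> ennreal (1/4) * ?A + ennreal (1/4) * ?A + ennreal K * ?B" .
  \<comment> \<open>Finiteness is what permits moving that half to the left.\<close>
  have Afin: "?A < \<infinity>"
  proof -
    define c where "c = enn2real (\<integral>\<^sup>+t\<in>{0 - 1<..2 * pi + h}. ennreal (norm (G t)) \<partial>lborel)"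
    have c: "(\<integral>\<^sup>+t\<in>{0 - 1<..2 * pi + h}. ennreal (norm (G t)) \<partial>lborel) = ennreal c"
      unfolding c_def using fin by (auto simp: less_top)
    have "n x \<le> c" if "x \<in> {0..<2 * pi}" for x
    proof -
      have "ennreal (n x) \<le> ennreal c"
        unfolding e1[symmetric] c[symmetric] local_L1_eq[OF G]
        using that by (intro nn_integral_mono) (auto simp: indicator_def)
      thus ?thesis by (simp add: c_def)
    qed
    hence "?A \<le> (\<integral>\<^sup>+x. ennreal (c powr p) * indicator {0..<2 * pi} x \<partial>lborel)"
      using n0 p by (intro nn_integral_mono) (auto simp: indicator_def intro!: ennreal_leI powr_mono2)
    also have "\<dots> < \<infinity>" by (simp add: nn_integral_cmult_indicator ennreal_mult_less_top)
    finally show ?thesis .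
  qed
  then obtain a where a: "?A = ennreal a" "a \<ge> 0" by (cases ?A) auto
  have 2: "?A \<le> ennreal (2 * K) * ?B"
  proof (cases "?B = \<infinity>")
    case True
    thus ?thesis using K by (simp add: ennreal_mult_top)
  next
    case False
    then obtain b where b: "?B = ennreal b" "b \<ge> 0" by (cases ?B) auto
    have "ennreal a \<le> ennreal (1/4 * a + 1/4 * a + K * b)"
    proof -
      have "ennreal (1/4 * a + 1/4 * a + K * b) = ennreal (1/4) * ennreal a + ennreal (1/4) * ennreal a + ennreal K * ennreal b"
        using a(2) b(2) K by (simp only: ennreal_plus ennreal_mult mult_nonneg_nonneg add_nonneg_nonneg divide_nonneg_nonneg zero_le_one zero_le_numeral less_imp_le)
      thus ?thesis using 1 unfolding a(1) b(1) by simp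
    qed
    hence "a \<le> 1/4 * a + 1/4 * a + K * b" using a b K by (subst (asm) ennreal_le_iff) auto
    hence "a \<le> 2 * K * b" by simp
    thus ?thesis unfolding a(1) b(1) using b K by (simp add: ennreal_mult[symmetric] ennreal_leI)
  qed
  have B: "?B = ennreal h * (\<integral>\<^sup>+x\<in>{0..<2 * pi}. E x \<partial>lborel)"
  proof -
    have "?B = (\<integral>\<^sup>+x. \<integral>\<^sup>+s. E (x + s) * indicator {0<..h} s * indicator {0..<2 * pi} x \<partial>lborel \<partial>lborel)"
      by (intro nn_integral_cong nn_integral_multc[symmetric]) measurable
    also have "\<dots> = (\<integral>\<^sup>+s. \<integral>\<^sup>+x. E (x + s) * indicator {0<..h} s * indicator {0..<2 * pi} x \<partial>lborel \<partial>lborel)"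
      by (rule lborel_pair.Fubini') measurable
    also have "\<dots> = (\<integral>\<^sup>+s. (\<integral>\<^sup>+x\<in>{0..<2 * pi}. E (x + s) \<partial>lborel) * indicator {0<..h} s \<partial>lborel)"
      by (intro nn_integral_cong) (auto simp: indicator_def)
    also have "\<dots> = (\<integral>\<^sup>+s. (\<integral>\<^sup>+x\<in>{0..<2 * pi}. E x \<partial>lborel) * indicator {0<..h} s \<partial>lborel)"
      using perE by (subst nn_integral_period_shift) auto
    also have "\<dots> = (\<integral>\<^sup>+x\<in>{0..<2 * pi}. E x \<partial>lborel) * ennreal h"
      using h by (simp add: nn_integral_cmult_indicator)
    finally show ?thesis by (simp add: mult.commute)
  qed
  have "(\<integral>\<^sup>+x\<in>{0..<2 * pi}. E x \<partial>lborel) =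
     (\<integral>\<^sup>+x. ennreal (h powr (p - 1)) * (ennreal (norm (G x) powr p) * indicator {0..<2 * pi} x) + diff_energy p m h G x * indicator {0..<2 * pi} x \<partial>lborel)"
    unfolding E_def total_energy_def by (intro nn_integral_cong) (auto simp: indicator_def ennreal_mult)
  also have "\<dots> = ennreal (h powr (p - 1)) * Lp_power p G + (\<integral>\<^sup>+x\<in>{0..<2 * pi}. diff_energy p m h G x \<partial>lborel)"
    unfolding Lp_power_def by (subst nn_integral_add) (auto simp: nn_integral_cmult)
  also have "(\<integral>\<^sup>+x\<in>{0..<2 * pi}. diff_energy p m h G x \<partial>lborel) =
      (\<integral>\<^sup>+t\<in>{0<..<h}. ennreal (t powr (p - 2)) * Lp_power p (finite_diff m t G) \<partial>lborel)"
  proof -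
    have "(\<integral>\<^sup>+x\<in>{0..<2 * pi}. diff_energy p m h G x \<partial>lborel) =
      (\<integral>\<^sup>+x. \<integral>\<^sup>+t. ennreal (t powr (p - 2) * norm (finite_diff m t G x) powr p) * indicator {0<..<h} t * indicator {0..<2 * pi} x \<partial>lborel \<partial>lborel)"
      unfolding diff_energy_def by (intro nn_integral_cong nn_integral_multc[symmetric]) measurable
    also have "\<dots> = (\<integral>\<^sup>+t. \<integral>\<^sup>+x. ennreal (t powr (p - 2) * norm (finite_diff m t G x) powr p) * indicator {0<..<h} t * indicator {0..<2 * pi} x \<partial>lborel \<partial>lborel)"
      by (rule lborel_pair.Fubini') measurable
    also have "\<dots> = (\<integral>\<^sup>+t\<in>{0<..<h}. ennreal (t powr (p - 2)) * Lp_power p (finite_diff m t G) \<partial>lborel)"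
    proof (rule nn_integral_cong)
      fix t
      have "(\<integral>\<^sup>+x. ennreal (t powr (p - 2) * norm (finite_diff m t G x) powr p) * indicator {0<..<h} t * indicator {0..<2 * pi} x \<partial>lborel)
        = (\<integral>\<^sup>+x. (ennreal (t powr (p - 2)) * indicator {0<..<h} t) * (ennreal (norm (finite_diff m t G x) powr p) * indicator {0..<2 * pi} x) \<partial>lborel)"
        by (intro nn_integral_cong) (simp add: ennreal_mult mult_ac)
      also have "\<dots> = (ennreal (t powr (p - 2)) * indicator {0<..<h} t) * Lp_power p (finite_diff m t G)"
        unfolding Lp_power_def by (intro nn_integral_cmult) measurable
      finally show "(\<integral>\<^sup>+x. ennreal (t powr (p - 2) * norm (finite_diff m t G x) powr p) * indicator {0<..<h} t * indicator {0..<2 * pi} x \<partial>lborel)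
        = ennreal (t powr (p - 2)) * Lp_power p (finite_diff m t G) * indicator {0<..<h} t" by (simp add: mult_ac)
    qed
    finally show ?thesis .
  qed
  finally have E: "(\<integral>\<^sup>+x\<in>{0..<2 * pi}. E x \<partial>lborel) = ennreal (h powr (p - 1)) * Lp_power p G +
    (\<integral>\<^sup>+t\<in>{0<..<h}. ennreal (t powr (p - 2)) * Lp_power p (finite_diff m t G) \<partial>lborel)" .
  have "ennreal h * ennreal (h powr (p - 1)) = ennreal (h powr p)"
    using h by (simp add: ennreal_mult[symmetric] powr_diff)
  hence "ennreal h * (\<integral>\<^sup>+x\<in>{0..<2 * pi}. E x \<partial>lborel) = ennreal (h powr p) * Lp_power p G +
     ennreal h * (\<integral>\<^sup>+t\<in>{0<..<h}. ennreal (t powr (p - 2)) * Lp_power p (finite_diff m t G) \<partial>lborel)"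
    unfolding E by (simp add: distrib_left mult.assoc[symmetric])
  with 2 B show ?thesis unfolding K_def n_def by simp
qed

section \<open>Moduli of smoothness of a function and of its derivative\<close>

lemma ennreal_powr_mono: "0 < a \<Longrightarrow> x \<le> y \<Longrightarrow> ennreal_powr x a \<le> ennreal_powr y a"
  unfolding ennreal_powr_def
  by (auto intro!: ennreal_leI powr_mono2 enn2real_mono simp: top_unique less_top)

lemma ennreal_powr_inverse:
  assumes "0 < a" "0 < b" "a * b = 1"
  shows "ennreal_powr (ennreal_powr x a) b = x"
  using assms by (cases x) (auto simp: ennreal_powr_def powr_powr)

lemma ennreal_powr_sum_le:
  assumes K: "0 < K" and a: "0 < a" and b: "0 < b" and q: "0 < q"
  shows "ennreal_powr (ennreal K * (ennreal a * X + ennreal b * Y)) q \<le>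
    ennreal ((2 * K) powr q) * (ennreal (a powr q) * ennreal_powr X q + ennreal (b powr q) * ennreal_powr Y q)"
proof (cases "X = \<infinity> \<or> Y = \<infinity>")
  case True
  thus ?thesis using assms by (auto simp: ennreal_powr_def ennreal_mult_top ennreal_top_mult)
next
  case False
  then obtain x y where xy: "X = ennreal x" "x \<ge> 0" "Y = ennreal y" "y \<ge> 0" by (cases X; cases Y) auto
  have nn: "0 \<le> K * (a * x + b * y)" using assms xy by simp
  have "ennreal K * (ennreal a * X + ennreal b * Y) = ennreal (K * (a * x + b * y))"
    using assms xy by (simp add: ennreal_mult ennreal_plus)
  hence "ennreal_powr (ennreal K * (ennreal a * X + ennreal b * Y)) q = ennreal ((K * (a * x + b * y)) powr q)"
    using nn by (simp add: ennreal_powr_def)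
  also have "\<dots> \<le> ennreal ((2 * K) powr q * (a powr q * x powr q + b powr q * y powr q))"
  proof (rule ennreal_leI)
    have "a * x + b * y \<le> 2 * max (a * x) (b * y)" by simp
    hence "K * (a * x + b * y) \<le> K * (2 * max (a * x) (b * y))" using K by (intro mult_left_mono) auto
    hence "(K * (a * x + b * y)) powr q \<le> (2 * K * max (a * x) (b * y)) powr q"
      using nn q by (intro powr_mono2) (auto simp: mult_ac)
    also have "\<dots> = (2 * K) powr q * max (a * x) (b * y) powr q"
      using assms xy by (simp add: powr_mult le_max_iff_disj)
    also have "max (a * x) (b * y) powr q \<le> (a * x) powr q + (b * y) powr q"
      by (auto simp: max_def)
    also have "\<dots> = a powr q * x powr q + b powr q * y powr q"
      using assms xy by (simp add: powr_mult)
    finally show "(K * (a * x + b * y)) powr q \<le> (2 * K) powr q * (a powr q * x powr q + b powr q * y powr q)"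
      by (simp add: mult_left_mono)
  qed
  also have "\<dots> = ennreal ((2 * K) powr q) * (ennreal (a powr q) * ennreal_powr X q + ennreal (b powr q) * ennreal_powr Y q)"
    using xy by (simp add: ennreal_powr_def ennreal_mult ennreal_plus)
  finally show ?thesis .
qed

lemma Lp_norm_circle_eq: "Lp_norm_circle p f = ennreal_powr (Lp_power p f) (1 / p)"
  by (simp add: Lp_norm_circle_def Lp_power_def)

lemma Lp_power_le_modulus:
  assumes "0 < p" "0 < h" "h \<le> \<delta>"
  shows "Lp_power p (finite_diff s h f) \<le> ennreal_powr (modulus_smoothness s f \<delta> p) p"
proof -
  have "Lp_norm_circle p (finite_diff s h f) \<le> modulus_smoothness s f \<delta> p"
    unfolding modulus_smoothness_def using assms by (intro SUP_upper) auto
  hence "ennreal_powr (Lp_norm_circle p (finite_diff s h f)) p \<le> ennreal_powr (modulus_smoothness s f \<delta> p) p"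
    using assms by (intro ennreal_powr_mono)
  thus ?thesis using assms by (simp add: Lp_norm_circle_eq ennreal_powr_inverse)
qed

lemma Lp_power_finite_diff_cong_AE:
  assumes "AE x in lborel. g x = g' x"
  shows "Lp_power p (finite_diff s h g) = Lp_power p (finite_diff s h g')"
proof -
  have "AE x in lborel. \<forall>\<nu>::nat. g (x + real \<nu> * h) = g' (x + real \<nu> * h)"
    unfolding AE_all_countable using AE_lborel_shift[OF assms] by blast
  hence "AE x in lborel. finite_diff s h g x = finite_diff s h g' x"
    by eventually_elim (simp add: finite_diff_def)
  thus ?thesis unfolding Lp_power_def by (intro nn_integral_cong_AE) (auto elim: eventually_mono)
qed

lemma nth_derivative_Suc: "nth_derivative (Suc n) f = (\<lambda>x. vector_derivative (nth_derivative n f) (at x))"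
  by (simp add: nth_derivative_def)

text \<open>The theorem for a single step \<open>h\<close> and with all norms raised to the power \<open>p\<close>. By the mean value
  inequality and the fundamental theorem, \<open>\<Delta>\<^sub>h\<^sup>r\<^sup>+\<^sup>k f (x)\<close> is at most \<open>h\<^sup>r\<^sup>-\<^sup>1\<close> times the \<open>L\<^sup>1\<close> norm of
  \<open>G = \<Delta>\<^sub>h\<^sup>k f\<^sup>(\<^sup>r\<^sup>)\<close> on \<open>(x, x + r h]\<close>, which is a sum of \<open>r\<close> translates of \<open>local_L1 G h\<close>. The embedding
  applies to \<open>G\<close>; its differences of order \<open>m\<close> are differences of order \<open>k\<close> of
  \<open>\<Delta>\<^sub>t\<^sup>m f\<^sup>(\<^sup>r\<^sup>)\<close> and therefore cost only a factor \<open>2 ^ k\<close>.\<close>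

lemma Lp_power_finite_diff_le_modulus:
  fixes f :: "real \<Rightarrow> complex"
  assumes p: "0 < p" "p < 1" and r: "r \<ge> 1" and m: "m \<ge> 1"
    and f: "deriv_in_AC_circle r f" and h: "0 < h" "h \<le> \<delta>"
  shows "Lp_power p (finite_diff (r + k) h f) \<le>
    ennreal (real r * (2 * (4 * (real m * 2 ^ (m + 2)) * 4 powr ((1 - p) / p))) * 2 ^ k) *
     (ennreal (\<delta> powr (real r * p)) * ennreal_powr (modulus_smoothness k (nth_derivative r f) \<delta> p) p +
      ennreal (\<delta> powr ((real r - 1) * p + 1)) *
        (\<integral>\<^sup>+t\<in>{0<..<\<delta>}. ennreal_powr (modulus_smoothness m (nth_derivative r f) t p) p
                      / ennreal (t powr (2 - p)) \<partial>lborel))"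
proof -
  obtain n where n: "r = Suc n" using r by (cases r) auto
  define K where "K = 2 * (4 * (real m * 2 ^ (m + 2)) * 4 powr ((1 - p) / p))"
  have K: "K > 0" using m by (simp add: K_def)
  define F where "F = nth_derivative n f"
  define g where "g = nth_derivative r f"
  have "F \<in> AC_circle" using f by (simp add: deriv_in_AC_circle_def F_def n)
  \<comment> \<open>The Borel representative of the derivative; the moduli of smoothness do not see the difference.\<close>
  then obtain g' where g': "periodic_2pi g'" "primitive F g'" "AE x in lborel. vector_derivative F (at x) = g' x"
    by (rule AC_circle_derivative)
  have AE: "AE x in lborel. g x = g' x" using g'(3) by (simp add: g_def n nth_derivative_Suc F_def)
  have g'm[measurable]: "g' \<in> borel_measurable borel" using g'(2) by (simp add: primitive_def)
  define G where "G = finite_diff k h g'"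
  have prG: "primitive (finite_diff k h F) G" unfolding G_def by (rule primitive_finite_diff) fact
  have Gm[measurable]: "G \<in> borel_measurable borel" using prG by (simp add: primitive_def)
  have perG: "periodic_2pi G" unfolding G_def using g'(1) by (rule finite_diff_periodic)
  have finG: "(\<integral>\<^sup>+t\<in>{a<..b}. ennreal (norm (G t)) \<partial>lborel) < \<infinity>" for a b
    by (rule primitive_locally_finite[OF prG])
  define N where "N = (\<lambda>x. enn2real (local_L1 G h x))"
  have N: "local_L1 G h x = ennreal (N x)" "0 \<le> N x" for x
    using local_L1_finite[OF finG Gm, of h x] by (auto simp: N_def less_top)
  have [measurable]: "N \<in> borel_measurable borel" unfolding N_def by measurable
  have "G (x + 2 * pi + s) = G (x + s)" for x s
    using spec[OF perG[unfolded periodic_2pi_def], of "x + s"] by (simp add: algebra_simps)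
  hence perN: "periodic_2pi N" by (simp add: periodic_2pi_def N_def local_L1_def)
  have pointwise: "norm (finite_diff (r + k) h f x) powr p \<le> h powr (real n * p) * (\<Sum>i<r. N (x + real i * h) powr p)" for x
  proof -
    define B where "B = enn2real (local_L1 G (real r * h) x)"
    have der: "(nth_derivative j f has_vector_derivative nth_derivative (Suc j) f y) (at y)" if "j < n" for j y
      using f that unfolding nth_derivative_Suc deriv_in_AC_circle_def n
      by (intro iffD1[OF vector_derivative_works]) auto
    have "norm (finite_diff (Suc n) h (finite_diff k h (nth_derivative 0 f)) x) \<le> h ^ n * B"
    proof (rule norm_finite_diff_le_derivative[where u = "\<lambda>j. finite_diff k h (nth_derivative j f)"])
      show "(finite_diff k h (nth_derivative j f) has_vector_derivative finite_diff k h (nth_derivative (Suc j) f) y) (at y)"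
        if "j < n" for j y
        by (rule has_vector_derivative_finite_diff) (rule der[OF that])
      show "norm (finite_diff k h (nth_derivative n f) z - finite_diff k h (nth_derivative n f) (z + h)) \<le> B"
        if "x \<le> z" "z \<le> x + real n * h" for z
        unfolding F_def[symmetric] B_def using that h
        by (intro primitive_norm_le[OF prG]) (auto simp: n algebra_simps)
    qed (use h in \<open>auto simp: B_def\<close>)
    also have "finite_diff (Suc n) h (finite_diff k h (nth_derivative 0 f)) = finite_diff (r + k) h f"
      unfolding n finite_diff_add by (simp add: nth_derivative_def)
    finally have 1: "norm (finite_diff (r + k) h f x) \<le> h ^ n * B" .
    have "B = (\<Sum>i<r. N (x + real i * h))"
      unfolding B_def using h N by (simp add: local_L1_multiple[OF Gm] sum_nonneg)
    hence Bp: "B powr p \<le> (\<Sum>i<r. N (x + real i * h) powr p)"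
      using N p by (simp add: powr_sum_le)
    have "norm (finite_diff (r + k) h f x) powr p \<le> (h ^ n * B) powr p"
      using 1 p by (intro powr_mono2) auto
    moreover have "(h ^ n * B) powr p = h powr (real n * p) * B powr p"
      using h by (simp add: powr_mult B_def powr_powr powr_realpow[symmetric])
    ultimately have "norm (finite_diff (r + k) h f x) powr p \<le> h powr (real n * p) * B powr p" by simp
    also have "\<dots> \<le> h powr (real n * p) * (\<Sum>i<r. N (x + real i * h) powr p)"
      by (intro mult_left_mono Bp) auto
    finally show ?thesis .
  qed
  have "Lp_power p (finite_diff (r + k) h f) \<le>
      (\<integral>\<^sup>+x. ennreal (h powr (real n * p)) * (\<Sum>i<r. ennreal (N (x + real i * h) powr p) * indicator {0..<2 * pi} x) \<partial>lborel)"
    unfolding Lp_power_def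
  proof (rule nn_integral_mono)
    fix x
    have "ennreal (norm (finite_diff (r + k) h f x) powr p) \<le> ennreal (h powr (real n * p)) * (\<Sum>i<r. ennreal (N (x + real i * h) powr p))"
      using pointwise[of x] by (simp add: sum_ennreal ennreal_mult[symmetric] sum_nonneg ennreal_leI)
    thus "ennreal (norm (finite_diff (r + k) h f x) powr p) * indicator {0..<2 * pi} x \<le>
       ennreal (h powr (real n * p)) * (\<Sum>i<r. ennreal (N (x + real i * h) powr p) * indicator {0..<2 * pi} x)"
      by (auto simp: indicator_def)
  qed
  also have "\<dots> = ennreal (h powr (real n * p)) * (\<Sum>i<r. (\<integral>\<^sup>+x\<in>{0..<2 * pi}. ennreal (N (x + real i * h) powr p) \<partial>lborel))"
    by (subst nn_integral_cmult, measurable, subst nn_integral_sum, measurable)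
  also have "\<dots> = ennreal (h powr (real n * p)) * (\<Sum>i<r. (\<integral>\<^sup>+x\<in>{0..<2 * pi}. ennreal (N x powr p) \<partial>lborel))"
    using perN by (intro arg_cong2[where f = "(*)"] sum.cong nn_integral_period_shift[where F = "\<lambda>x. ennreal (N x powr p)"])
      (auto simp: periodic_2pi_def)
  also have "\<dots> = ennreal (h powr (real n * p)) * (ennreal (real r) * (\<integral>\<^sup>+x\<in>{0..<2 * pi}. ennreal (N x powr p) \<partial>lborel))"
    by (simp add: ennreal_of_nat_eq_real_of_nat)
  also have "\<dots> \<le> ennreal (h powr (real n * p)) * (ennreal (real r) * (ennreal K * (ennreal (h powr p) * Lp_power p G +
      ennreal h * (\<integral>\<^sup>+t\<in>{0<..<h}. ennreal (t powr (p - 2)) * Lp_power p (finite_diff m t G) \<partial>lborel))))"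
    unfolding N_def K_def by (intro mult_left_mono local_L1_Lp_le[OF Gm perG finG p m h(1)]) auto
  also have "\<dots> \<le> ennreal (h powr (real n * p)) * (ennreal (real r) * (ennreal K * (ennreal (h powr p) * (2 ^ k * W) +
      ennreal h * (2 ^ k * J))))"
    if W: "Lp_power p G \<le> 2 ^ k * W"
      and J: "(\<integral>\<^sup>+t\<in>{0<..<h}. ennreal (t powr (p - 2)) * Lp_power p (finite_diff m t G) \<partial>lborel) \<le> 2 ^ k * J" for W J
    by (intro mult_left_mono add_mono W J) auto
  finally have main: "Lp_power p (finite_diff (r + k) h f) \<le>
      ennreal (h powr (real n * p)) * (ennreal (real r) * (ennreal K * (ennreal (h powr p) * (2 ^ k * W) + ennreal h * (2 ^ k * J))))"
    if "Lp_power p G \<le> 2 ^ k * W"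
      "(\<integral>\<^sup>+t\<in>{0<..<h}. ennreal (t powr (p - 2)) * Lp_power p (finite_diff m t G) \<partial>lborel) \<le> 2 ^ k * J" for W J
    using that by blast
  define W where "W = ennreal_powr (modulus_smoothness k g \<delta> p) p"
  define J where "J = (\<integral>\<^sup>+t\<in>{0<..<\<delta>}. ennreal_powr (modulus_smoothness m g t p) p / ennreal (t powr (2 - p)) \<partial>lborel)"
  have W: "Lp_power p G \<le> 2 ^ k * W"
  proof -
    have "Lp_power p G = Lp_power p (finite_diff k h g)"
      unfolding G_def by (rule Lp_power_finite_diff_cong_AE[OF AE, symmetric])
    also have "\<dots> \<le> W" unfolding W_def using p h by (intro Lp_power_le_modulus) auto
    also have "\<dots> \<le> 2 ^ k * W" using mult_right_mono[of 1 "2 ^ k" W] one_le_power[of "2::ennreal" k] by simp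
    finally show ?thesis .
  qed
  have J: "(\<integral>\<^sup>+t\<in>{0<..<h}. ennreal (t powr (p - 2)) * Lp_power p (finite_diff m t G) \<partial>lborel) \<le> 2 ^ k * J"
  proof -
    have [measurable]: "(\<lambda>t. Lp_power p (finite_diff m t g')) \<in> borel_measurable borel"
      unfolding Lp_power_def by measurable
    have "(\<integral>\<^sup>+t\<in>{0<..<h}. ennreal (t powr (p - 2)) * Lp_power p (finite_diff m t G) \<partial>lborel) \<le>
      (\<integral>\<^sup>+t. 2 ^ k * (ennreal (t powr (p - 2)) * Lp_power p (finite_diff m t g') * indicator {0<..<h} t) \<partial>lborel)"
    proof (rule nn_integral_mono)
      fix t
      have "Lp_power p (finite_diff m t G) \<le> 2 ^ k * Lp_power p (finite_diff m t g')"
        unfolding G_def finite_diff_commute[of m t] using p g'(1)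
        by (intro Lp_power_finite_diff_le finite_diff_periodic) auto
      hence "ennreal (t powr (p - 2)) * Lp_power p (finite_diff m t G) * indicator {0<..<h} t \<le>
         ennreal (t powr (p - 2)) * (2 ^ k * Lp_power p (finite_diff m t g')) * indicator {0<..<h} t"
        by (intro mult_right_mono mult_left_mono) auto
      thus "ennreal (t powr (p - 2)) * Lp_power p (finite_diff m t G) * indicator {0<..<h} t \<le>
         2 ^ k * (ennreal (t powr (p - 2)) * Lp_power p (finite_diff m t g') * indicator {0<..<h} t)"
        by (simp add: mult_ac)
    qed
    also have "\<dots> = 2 ^ k * (\<integral>\<^sup>+t. ennreal (t powr (p - 2)) * Lp_power p (finite_diff m t g') * indicator {0<..<h} t \<partial>lborel)"
      by (intro nn_integral_cmult) measurable
    also have "\<dots> \<le> 2 ^ k * J"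
      unfolding J_def
    proof (intro mult_left_mono nn_integral_mono)
      fix t
      show "ennreal (t powr (p - 2)) * Lp_power p (finite_diff m t g') * indicator {0<..<h} t \<le>
        ennreal_powr (modulus_smoothness m g t p) p / ennreal (t powr (2 - p)) * indicator {0<..<\<delta>} t"
      proof (cases "t \<in> {0<..<h}")
        case True
        have "Lp_power p (finite_diff m t g') = Lp_power p (finite_diff m t g)"
          by (rule Lp_power_finite_diff_cong_AE[OF AE, symmetric])
        also have "\<dots> \<le> ennreal_powr (modulus_smoothness m g t p) p"
          using True p by (intro Lp_power_le_modulus) auto
        finally have "ennreal (t powr (p - 2)) * Lp_power p (finite_diff m t g') \<le> ennreal (t powr (p - 2)) * ennreal_powr (modulus_smoothness m g t p) p"
          by (intro mult_left_mono) auto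
        also have "\<dots> = ennreal_powr (modulus_smoothness m g t p) p / ennreal (t powr (2 - p))"
          using True powr_minus[of t "2 - p"] by (simp add: divide_ennreal_def inverse_ennreal mult.commute)
        finally show ?thesis using True h by (simp add: indicator_def)
      qed simp
    qed auto
    finally show ?thesis .
  qed
  have "Lp_power p (finite_diff (r + k) h f) \<le>
      ennreal (h powr (real n * p)) * (ennreal (real r) * (ennreal K * (ennreal (h powr p) * (2 ^ k * W) + ennreal h * (2 ^ k * J))))"
    by (rule main[OF W J])
  also have "\<dots> = ennreal (real r * K * 2 ^ k) * ((ennreal (h powr (real n * p)) * ennreal (h powr p)) * W + (ennreal (h powr (real n * p)) * ennreal h) * J)"
    using K by (simp add: ennreal_mult ennreal_power[symmetric] algebra_simps)
  also have "\<dots> \<le> ennreal (real r * K * 2 ^ k) * (ennreal (\<delta> powr (real r * p)) * W + ennreal (\<delta> powr ((real r - 1) * p + 1)) * J)"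
  proof (intro mult_left_mono add_mono mult_right_mono)
    have "h powr (real n * p) * h powr p = h powr (real r * p)"
      using h by (simp add: powr_add[symmetric] n algebra_simps)
    also have "\<dots> \<le> \<delta> powr (real r * p)" using h p by (intro powr_mono2) auto
    finally show "ennreal (h powr (real n * p)) * ennreal (h powr p) \<le> ennreal (\<delta> powr (real r * p))"
      by (simp add: ennreal_mult[symmetric] ennreal_leI)
    have "h powr (real n * p) * h = h powr ((real r - 1) * p + 1)"
      using h by (simp add: powr_add n)
    also have "\<dots> \<le> \<delta> powr ((real r - 1) * p + 1)" using h p by (intro powr_mono2) (auto simp: n)
    finally show "ennreal (h powr (real n * p)) * ennreal h \<le> ennreal (\<delta> powr ((real r - 1) * p + 1))"
      using h by (simp add: ennreal_mult[symmetric] ennreal_leI)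
  qed auto
  finally show ?thesis unfolding W_def J_def K_def g_def .
qed

theorem theorem2p4:
  fixes p :: real and k r m :: nat
  assumes "0 < p" and "p < 1"
    and "k \<ge> 1" and "r \<ge> 1" and "m \<ge> 1"
  shows "\<exists>C::real. C > 0 \<and>
    (\<forall>f::real \<Rightarrow> complex. deriv_in_AC_circle r f \<longrightarrow>
      (\<forall>\<delta>::real. \<delta> > 0 \<longrightarrow>
        modulus_smoothness (r + k) f \<delta> p
          \<le> ennreal C * ennreal (\<delta> ^ r) * modulus_smoothness k (nth_derivative r f) \<delta> p
            + ennreal C * ennreal (\<delta> powr (real r + 1 / p - 1))
              * ennreal_powr
                  (\<integral>\<^sup>+t\<in>{0<..<\<delta>}. ennreal_powr (modulus_smoothness m (nth_derivative r f) t p) p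
                      / ennreal (t powr (2 - p)) \<partial>lborel)
                  (1 / p)))"
proof -
  define K where "K = real r * (2 * (4 * (real m * 2 ^ (m + 2)) * 4 powr ((1 - p) / p))) * 2 ^ k"
  \<comment> \<open>The factor \<open>2\<close> pays for splitting the sum of two terms under the power \<open>1/p\<close>.\<close>
  define C where "C = (2 * K) powr (1 / p)"
  have K: "K > 0" using assms by (simp add: K_def)
  show ?thesis
  proof (intro exI[of _ C] conjI allI impI)
    show "C > 0" using K by (simp add: C_def)
    fix f :: "real \<Rightarrow> complex" and \<delta> :: real
    assume f: "deriv_in_AC_circle r f" and \<delta>: "\<delta> > 0"
    define \<omega> where "\<omega> = modulus_smoothness k (nth_derivative r f) \<delta> p"
    define J where "J = (\<integral>\<^sup>+t\<in>{0<..<\<delta>}. ennreal_powr (modulus_smoothness m (nth_derivative r f) t p) p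
                      / ennreal (t powr (2 - p)) \<partial>lborel)"
    have "modulus_smoothness (r + k) f \<delta> p \<le>
      ennreal C * (ennreal (\<delta> ^ r) * \<omega> + ennreal (\<delta> powr (real r + 1 / p - 1)) * ennreal_powr J (1 / p))"
      unfolding modulus_smoothness_def[of "r + k"]
    proof (rule SUP_least)
      fix h assume h: "h \<in> {0<..\<delta>}"
      have "Lp_norm_circle p (finite_diff (r + k) h f) \<le>
        ennreal_powr (ennreal K * (ennreal (\<delta> powr (real r * p)) * ennreal_powr \<omega> p + ennreal (\<delta> powr ((real r - 1) * p + 1)) * J)) (1 / p)"
        unfolding Lp_norm_circle_eq K_def \<omega>_def J_def
        using assms h f by (intro ennreal_powr_mono Lp_power_finite_diff_le_modulus) auto
      also have "\<dots> \<le> ennreal C * (ennreal ((\<delta> powr (real r * p)) powr (1 / p)) * ennreal_powr (ennreal_powr \<omega> p) (1 / p) +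
         ennreal ((\<delta> powr ((real r - 1) * p + 1)) powr (1 / p)) * ennreal_powr J (1 / p))"
        unfolding C_def using assms K \<delta> by (intro ennreal_powr_sum_le) auto
      also have "ennreal_powr (ennreal_powr \<omega> p) (1 / p) = \<omega>"
        using assms by (intro ennreal_powr_inverse) auto
      also have "(\<delta> powr (real r * p)) powr (1 / p) = \<delta> ^ r"
        using assms \<delta> by (simp add: powr_powr powr_realpow)
      also have "(\<delta> powr ((real r - 1) * p + 1)) powr (1 / p) = \<delta> powr (real r + 1 / p - 1)"
        using assms by (simp add: powr_powr add_divide_distrib) (simp add: algebra_simps)
      finally show "Lp_norm_circle p (finite_diff (r + k) h f) \<le>
        ennreal C * (ennreal (\<delta> ^ r) * \<omega> + ennreal (\<delta> powr (real r + 1 / p - 1)) * ennreal_powr J (1 / p))" .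
    qed
    thus "modulus_smoothness (r + k) f \<delta> p
          \<le> ennreal C * ennreal (\<delta> ^ r) * modulus_smoothness k (nth_derivative r f) \<delta> p
            + ennreal C * ennreal (\<delta> powr (real r + 1 / p - 1))
              * ennreal_powr
                  (\<integral>\<^sup>+t\<in>{0<..<\<delta>}. ennreal_powr (modulus_smoothness m (nth_derivative r f) t p) p
                      / ennreal (t powr (2 - p)) \<partial>lborel)
                  (1 / p)"
      by (simp add: \<omega>_def J_def distrib_left mult.assoc)
  qed
qed

end
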